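(* Let $\Phi$ be a finite root system, $m\ge 0$ an integer, and $\emptyset\ne J\subset I$. If $\alpha^k,\beta^l\in\Phi^m_{\ge -1}$ and $\alpha,\beta\in\Phi_J$, then $\alpha^k$ and $\beta^l$ are compatible in $\Phi^m_{\ge-1}$ if and only if they are compatible in $(\Phi_J)^m_{\ge-1}$.
   Context: $\Phi$ is a finite (reduced, not necessarily crystallographic) root system with positive roots $\Phi_{>0}$, simple roots $\{\alpha_i: i\in I\}$, simple reflections $s_i$. For nonempty $J\subset I$, $\Phi_J$ is the parabolic root subsystem spanned by the simple roots $\alpha_j$, $j\in J$ (with these as its simple roots). Set $\Phi_{\ge -1}=\Phi_{>0}\cup\{-\alpha_i:i\in I\}$. Fix a decomposition $I=I_+\sqcup I_-$ such that each of $I_+,I_-$ is a totally disconnected set of vertices of the Coxeter diagram; for $\Phi_J$ (and for irreducible components) use the induced decomposition $J_\pm=J\cap I_\pm$. Irreducible case. For $\varepsilon\in\{+,-\}$ define $\tau_\varepsilon:\Phi_{\ge-1}\to\Phi_{\ge-1}$ by $\tau_\varepsilon(\alpha)=\alpha$ if $\alpha=-\alpha_i$ with $i\in I_{-\varepsilon}$, and $\tau_\varepsilon(\alpha)=\bigl(\prod_{i\in I_\varepsilon}s_i\bigr)(\alpha)$ otherwise. Put $R=\tau_-\tau_+$ (apply $\tau_+$ first). Compatibility relations are symmetric and considered on pairs of distinct elements. Non-colored compatibility on $\Phi_{\ge-1}$ is the (known to exist) unique symmetric relation such that: $\alpha,\beta$ are compatible iff $R(\alpha),R(\beta)$ are compatible;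 $-\alpha_i$ is compatible with $\beta\in\Phi_{\ge -1}$, $\beta\neq-\alpha_i$, iff the simple root expansion of $\beta$ does not involve $\alpha_i$. Let $d(\beta)\ge 0$ be the smallest $d$ such that $R^d(\beta)$ is a negative root. Colored roots: $\Phi^m_{\ge-1}=\{\alpha^k:\alpha\in\Phi_{>0},\,1\le k\le m\}\cup\{(-\alpha_i)^1:i\in I\}$. Two colored roots $\alpha^k,\beta^l$ are compatible iff one of the following holds: - $k>l$, $d(\alpha)\le d(\beta)$, and $R(\alpha)$ and $\beta$ are compatible; - $k<l$, $d(\alpha)\ge d(\beta)$, and $\alpha$ and $R(\beta)$ are compatible; - $k>l$, $d(\alpha)>d(\beta)$, and $\alpha$ and $\beta$ are compatible; - $k<l$, $d(\alpha)<d(\beta)$, and $\alpha$ and $\beta$ are compatible; - $k=l$, and $\alpha$ and $\beta$ are compatible. Reducible case. If $\Phi$ has irreducible components $\Phi_1,\dots,\Phi_l$, then $\Phi^m_{\ge-1}$ is the disjoint union of the $(\Phi_j)^m_{\ge-1}$, and two colored roots are compatible iff they belong to different components, or belong to the same component and are compatible within it. *)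

theory Defs
  imports "HOL-Analysis.Analysis"
begin

definition refl_along :: "'v::real_inner \<Rightarrow> 'v \<Rightarrow> 'v" where
  "refl_along \<alpha> x = x - (2 * (x \<bullet> \<alpha>) / (\<alpha> \<bullet> \<alpha>)) *\<^sub>R \<alpha>"

(* Finite reduced root systems, not necessarily crystallographic.  They are not required to span
   the ambient space, so that root subsystems live in the same space. *)
definition root_system :: "'v::real_inner set \<Rightarrow> bool" where
  "root_system \<Phi> \<longleftrightarrow>
     finite \<Phi> \<and> 0 \<notin> \<Phi> \<and>
     (\<forall>\<alpha>\<in>\<Phi>. \<Phi> \<inter> span {\<alpha>} = {\<alpha>, - \<alpha>}) \<and>
     (\<forall>\<alpha>\<in>\<Phi>. refl_along \<alpha> ` \<Phi> = \<Phi>)"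

definition nonneg_comb :: "('i \<Rightarrow> 'v::real_vector) \<Rightarrow> 'i set \<Rightarrow> 'v \<Rightarrow> bool" where
  "nonneg_comb a I v \<longleftrightarrow> (\<exists>c. (\<forall>i\<in>I. 0 \<le> c i) \<and> v = (\<Sum>i\<in>I. c i *\<^sub>R a i))"

definition simple_roots :: "'v::real_inner set \<Rightarrow> ('i \<Rightarrow> 'v) \<Rightarrow> 'i set \<Rightarrow> bool" where
  "simple_roots \<Phi> a I \<longleftrightarrow>
     inj_on a I \<and> a ` I \<subseteq> \<Phi> \<and> independent (a ` I) \<and>
     (\<forall>\<beta>\<in>\<Phi>. nonneg_comb a I \<beta> \<or> nonneg_comb a I (- \<beta>))"

definition pos_roots :: "'v::real_inner set \<Rightarrow> ('i \<Rightarrow> 'v) \<Rightarrow> 'i set \<Rightarrow> 'v set" where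
  "pos_roots \<Phi> a I = {\<beta>\<in>\<Phi>. nonneg_comb a I \<beta>}"

definition involves :: "('i \<Rightarrow> 'v::real_vector) \<Rightarrow> 'i set \<Rightarrow> 'v \<Rightarrow> 'i \<Rightarrow> bool" where
  "involves a I \<beta> i \<longleftrightarrow> representation (a ` I) \<beta> (a i) \<noteq> 0"

(* Edges of the Coxeter diagram: the order of s_i s_j is at least 3. *)
definition coxeter_edge :: "('i \<Rightarrow> 'v::real_inner) \<Rightarrow> 'i \<Rightarrow> 'i \<Rightarrow> bool" where
  "coxeter_edge a i j \<longleftrightarrow>
     i \<noteq> j \<and> refl_along (a i) \<circ> refl_along (a j) \<noteq> refl_along (a j) \<circ> refl_along (a i)"

definition totally_disconnected :: "('i \<Rightarrow> 'v::real_inner) \<Rightarrow> 'i set \<Rightarrow> bool" where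
  "totally_disconnected a K \<longleftrightarrow> (\<forall>i\<in>K. \<forall>j\<in>K. \<not> coxeter_edge a i j)"

definition parabolic :: "'v::real_inner set \<Rightarrow> ('i \<Rightarrow> 'v) \<Rightarrow> 'i set \<Rightarrow> 'v set" where
  "parabolic \<Phi> a J = \<Phi> \<inter> span (a ` J)"

definition irreducible_root_system :: "'v::real_inner set \<Rightarrow> bool" where
  "irreducible_root_system \<Phi> \<longleftrightarrow>
     \<Phi> \<noteq> {} \<and>
     \<not> (\<exists>A B. A \<noteq> {} \<and> B \<noteq> {} \<and> A \<inter> B = {} \<and> A \<union> B = \<Phi> \<and> (\<forall>x\<in>A. \<forall>y\<in>B. x \<bullet> y = 0))"

definition irreducible_components :: "'v::real_inner set \<Rightarrow> 'v set set" where
  "irreducible_components \<Phi> =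
     {\<Psi>. \<Psi> \<subseteq> \<Phi> \<and> irreducible_root_system \<Psi> \<and> (\<forall>x\<in>\<Psi>. \<forall>y\<in>\<Phi> - \<Psi>. x \<bullet> y = 0)}"

(* The indices of the simple roots of the component \<Psi>. *)
definition idx_in :: "'v set \<Rightarrow> ('i \<Rightarrow> 'v) \<Rightarrow> 'i set \<Rightarrow> 'i set" where
  "idx_in \<Psi> a K = {i\<in>K. a i \<in> \<Psi>}"

definition almost_pos_roots :: "'v::real_inner set \<Rightarrow> ('i \<Rightarrow> 'v) \<Rightarrow> 'i set \<Rightarrow> 'v set" where
  "almost_pos_roots \<Phi> a I = pos_roots \<Phi> a I \<union> (\<lambda>i. - a i) ` I"

(* In everything below the index set of the simple roots is Ipos \<union> Ineg, the sets Ipos and Ineg being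
   the two parts I_+ and I_- of its decomposition. *)

(* tau a E E' is the map tau_e with E = I_e and E' = I_{-e}.  The product of the s_i with i in E
   is written as a fold over the set E, which is independent of the order because the s_i commute
   when E is totally disconnected. *)
definition tau :: "('i \<Rightarrow> 'v::real_inner) \<Rightarrow> 'i set \<Rightarrow> 'i set \<Rightarrow> 'v \<Rightarrow> 'v" where
  "tau a E E' x =
     (if \<exists>i\<in>E'. x = - a i then x else Finite_Set.fold (\<lambda>i. refl_along (a i)) x E)"

definition rot :: "('i \<Rightarrow> 'v::real_inner) \<Rightarrow> 'i set \<Rightarrow> 'i set \<Rightarrow> 'v \<Rightarrow> 'v" where
  "rot a Ipos Ineg = tau a Ineg Ipos \<circ> tau a Ipos Ineg"

(* Compatibility concerns pairs of distinct roots, hence irrefl.  In the colored relation below,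
   the case R \<alpha> = \<beta> with k > l and d \<alpha> \<le> d \<beta> cannot occur: it forces d \<alpha> = 0, so k = 1. *)
definition is_compat_relation ::
    "'v::real_inner set \<Rightarrow> ('i \<Rightarrow> 'v) \<Rightarrow> 'i set \<Rightarrow> 'i set \<Rightarrow> ('v \<times> 'v) set \<Rightarrow> bool" where
  "is_compat_relation \<Phi> a Ipos Ineg C \<longleftrightarrow>
     (let I = Ipos \<union> Ineg; P = almost_pos_roots \<Phi> a I; R = rot a Ipos Ineg in
       C \<subseteq> P \<times> P \<and> irrefl C \<and> sym C \<and>
       (\<forall>\<alpha>\<in>P. \<forall>\<beta>\<in>P. (\<alpha>, \<beta>) \<in> C \<longleftrightarrow> (R \<alpha>, R \<beta>) \<in> C) \<and>
       (\<forall>i\<in>I. \<forall>\<beta>\<in>P. \<beta> \<noteq> - a i \<longrightarrow> ((- a i, \<beta>) \<in> C \<longleftrightarrow> \<not> involves a I \<beta> i)))"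

(* For irreducible \<Phi> exactly one such relation exists (Fomin and Zelevinsky). *)
definition compat_relation ::
    "'v::real_inner set \<Rightarrow> ('i \<Rightarrow> 'v) \<Rightarrow> 'i set \<Rightarrow> 'i set \<Rightarrow> ('v \<times> 'v) set" where
  "compat_relation \<Phi> a Ipos Ineg = (THE C. is_compat_relation \<Phi> a Ipos Ineg C)"

definition depth ::
    "'v::real_inner set \<Rightarrow> ('i \<Rightarrow> 'v) \<Rightarrow> 'i set \<Rightarrow> 'i set \<Rightarrow> 'v \<Rightarrow> nat" where
  "depth \<Phi> a Ipos Ineg \<beta> = (LEAST d. - (rot a Ipos Ineg ^^ d) \<beta> \<in> pos_roots \<Phi> a (Ipos \<union> Ineg))"

(* The colored root \<alpha>^k is the pair (\<alpha>, k). *)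
definition colored_roots ::
    "'v::real_inner set \<Rightarrow> ('i \<Rightarrow> 'v) \<Rightarrow> 'i set \<Rightarrow> nat \<Rightarrow> ('v \<times> nat) set" where
  "colored_roots \<Phi> a I m =
     {(\<alpha>, k) | \<alpha> k. \<alpha> \<in> pos_roots \<Phi> a I \<and> 1 \<le> k \<and> k \<le> m} \<union> {(- a i, 1) | i. i \<in> I}"

(* Colored compatibility for irreducible \<Phi>. *)
fun compat_irreducible ::
    "'v::real_inner set \<Rightarrow> ('i \<Rightarrow> 'v) \<Rightarrow> 'i set \<Rightarrow> 'i set \<Rightarrow> nat \<Rightarrow>
     'v \<times> nat \<Rightarrow> 'v \<times> nat \<Rightarrow> bool" where
  "compat_irreducible \<Phi> a Ipos Ineg m (\<alpha>, k) (\<beta>, l) \<longleftrightarrow>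
     (let C = compat_relation \<Phi> a Ipos Ineg; d = depth \<Phi> a Ipos Ineg; R = rot a Ipos Ineg;
          M = colored_roots \<Phi> a (Ipos \<union> Ineg) m in
       (\<alpha>, k) \<in> M \<and> (\<beta>, l) \<in> M \<and>
       (k > l \<and> d \<alpha> \<le> d \<beta> \<and> (R \<alpha>, \<beta>) \<in> C \<or>
        k < l \<and> d \<alpha> \<ge> d \<beta> \<and> (\<alpha>, R \<beta>) \<in> C \<or>
        k > l \<and> d \<alpha> > d \<beta> \<and> (\<alpha>, \<beta>) \<in> C \<or>
        k < l \<and> d \<alpha> < d \<beta> \<and> (\<alpha>, \<beta>) \<in> C \<or>
        k = l \<and> (\<alpha>, \<beta>) \<in> C))"

definition compatible ::
    "'v::real_inner set \<Rightarrow> ('i \<Rightarrow> 'v) \<Rightarrow> 'i set \<Rightarrow> 'i set \<Rightarrow> nat \<Rightarrow>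
     'v \<times> nat \<Rightarrow> 'v \<times> nat \<Rightarrow> bool" where
  "compatible \<Phi> a Ipos Ineg m x y \<longleftrightarrow>
     (\<exists>\<Psi>\<^sub>1\<in>irreducible_components \<Phi>. \<exists>\<Psi>\<^sub>2\<in>irreducible_components \<Phi>. \<Psi>\<^sub>1 \<noteq> \<Psi>\<^sub>2 \<and>
        x \<in> colored_roots \<Psi>\<^sub>1 a (idx_in \<Psi>\<^sub>1 a (Ipos \<union> Ineg)) m \<and>
        y \<in> colored_roots \<Psi>\<^sub>2 a (idx_in \<Psi>\<^sub>2 a (Ipos \<union> Ineg)) m) \<or>
     (\<exists>\<Psi>\<in>irreducible_components \<Phi>.
        compat_irreducible \<Psi> a (idx_in \<Psi> a Ipos) (idx_in \<Psi> a Ineg) m x y)"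

end

theory Submission
  imports Defs
begin

text \<open>
The definition of colored compatibility refers to the rotation \<open>R\<close> and to the depth function \<open>d\<close>, and
neither of them restricts to \<open>\<Phi>\<^sub>J\<close>. The proof rewrites it as a condition that only sees coordinates with
respect to the simple roots and inner products of simple roots; such a condition is the same in \<open>\<Phi>\<close>
and in \<open>\<Phi>\<^sub>J\<close>.

In the formal text \<open>P\<close> and \<open>N\<close> stand for \<open>I\<^sub>+\<close> and
\<open>I\<^sub>-\<close>. Write \<open>x = x\<^sub>+ + x\<^sub>-\<close> for the decomposition along the simple roots
of \<open>I\<^sub>+\<close> and \<open>I\<^sub>-\<close>. The Euler form is \<open>E(x, y) = x\<^sub>+ \<bullet>
y\<^sub>+ / 2 + x\<^sub>- \<bullet> y\<^sub>- / 2 + x\<^sub>- \<bullet> y\<^sub>+\<close>, a bilinear form with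
\<open>E(x, y) + E(y, x) = x \<bullet> y\<close>. Let \<open>c\<close> be the product of the simple reflections from
\<open>I\<^sub>+\<close> followed by those from \<open>I\<^sub>-\<close>. Then \<open>E(y, c x) = - E(x, y)\<close>
(\<open>euler_serre\<close>), so \<open>E\<close> is invariant under \<open>c\<close>, and \<open>c\<close> fixes only
\<open>0\<close>. On a positive root \<open>R\<close> agrees with \<open>c\<close>, except that \<open>R\<close> sends
the root \<open>Pr i\<close> (\<open>proj_root\<close>) to \<open>- \<alpha>\<^sub>i\<close>, while \<open>c\<close>
sends it to \<open>- In i\<close> (\<open>inj_root\<close>); moreover \<open>R (- \<alpha>\<^sub>i) = In i\<close>.
The values \<open>E(Pr i, y) = E(y, In i)\<close> are the coefficient of \<open>\<alpha>\<^sub>i\<close> in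
\<open>y\<close> times \<open>\<alpha>\<^sub>i \<bullet> \<alpha>\<^sub>i / 2\<close>, and in particular they are
nonnegative for positive \<open>y\<close>.

Two distinct positive roots are compatible iff \<open>E(\<alpha>, \<beta>)\<close> and \<open>E(\<beta>, \<alpha>)\<close> are both nonnegative. With
the prescribed compatibility with negative simple roots this is an \<open>R\<close>-invariant relation
(\<open>ec_rot\<close>); it is the only one, since every \<open>R\<close>-orbit meets the negative simple roots: the sum over a
\<open>c\<close>-orbit of positive roots would be a nonzero vector fixed by \<open>c\<close>. For colors \<open>k > l\<close>, moving the
pair along \<open>R\<close> until one member is a negative simple root shows, for positive \<open>\<beta>\<close>, that both the case
\<open>d(\<alpha>) \<le> d(\<beta>)\<close> and the case \<open>d(\<alpha>) > d(\<beta>)\<close> of the definition amount to \<open>E(\<alpha>, \<beta>) = 0\<close>, so the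
depth disappears (\<open>higher_color_iff\<close>).

Between different irreducible components \<open>E\<close> vanishes and the criterion holds, so the criterion also
describes compatibility in reducible root systems (\<open>compatible_iff_colored_compat\<close>). For crystallographic
\<open>\<Phi>\<close> the facts used about \<open>E\<close>, \<open>Pr i\<close>, \<open>In i\<close> and \<open>c\<close> are those of the Euler form, the
projectives, the injectives and the Auslander-Reiten translation of a bipartite quiver or species;
they are verified here by linear algebra.
\<close>

section \<open>Coordinates with respect to the simple roots\<close>

definition coord :: "('i \<Rightarrow> 'v::real_vector) \<Rightarrow> 'i set \<Rightarrow> 'v \<Rightarrow> 'i \<Rightarrow> real" where
  "coord a I x i = representation (a ` I) x (a i)"

definition simple_part :: "('i \<Rightarrow> 'v::real_vector) \<Rightarrow> 'i set \<Rightarrow> 'i set \<Rightarrow> 'v \<Rightarrow> 'v" where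
  "simple_part a I K x = (\<Sum>i\<in>K. coord a I x i *\<^sub>R a i)"

locale indexed_basis =
  fixes a :: "'i \<Rightarrow> 'v::real_inner" and I :: "'i set"
  assumes finite_I: "finite I" and inj_a: "inj_on a I" and indep_a: "independent (a ` I)"
begin

lemma in_span_a: "i \<in> I \<Longrightarrow> a i \<in> span (a ` I)"
  by (auto intro: span_base)

lemma coord_expand:
  assumes "x \<in> span (a ` I)"
  shows "(\<Sum>i\<in>I. coord a I x i *\<^sub>R a i) = x"
  using sum_representation_eq[OF indep_a assms _ subset_refl] finite_I
  by (simp add: coord_def sum.reindex[OF inj_a] o_def)

lemma coord_a:
  assumes "i \<in> I" "j \<in> I"
  shows "coord a I (a i) j = (if j = i then 1 else 0)"
  using representation_basis[OF indep_a, of "a i"] assms inj_onD[OF inj_a, of j i]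
  by (auto simp: coord_def)

lemma coord_diff: "x \<in> span (a ` I) \<Longrightarrow> y \<in> span (a ` I) \<Longrightarrow> coord a I (x - y) i = coord a I x i - coord a I y i"
  unfolding coord_def by (simp add: representation_diff[OF indep_a])

lemma coord_minus: "x \<in> span (a ` I) \<Longrightarrow> coord a I (- x) i = - coord a I x i"
  unfolding coord_def by (simp add: representation_neg[OF indep_a])

lemma coord_scale: "x \<in> span (a ` I) \<Longrightarrow> coord a I (r *\<^sub>R x) i = r * coord a I x i"
  unfolding coord_def by (simp add: representation_scale[OF indep_a])

lemma coord_sum:
  "(\<And>k. k \<in> K \<Longrightarrow> f k \<in> span (a ` I)) \<Longrightarrow> coord a I (\<Sum>k\<in>K. f k) i = (\<Sum>k\<in>K. coord a I (f k) i)"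
  unfolding coord_def by (simp add: representation_sum[OF indep_a])

lemma comb_in_span: "K \<subseteq> I \<Longrightarrow> (\<Sum>k\<in>K. c k *\<^sub>R a k) \<in> span (a ` I)"
  by (intro span_sum span_scale in_span_a) auto

lemma coord_comb:
  assumes "K \<subseteq> I" "i \<in> I"
  shows "coord a I (\<Sum>k\<in>K. c k *\<^sub>R a k) i = (if i \<in> K then c i else 0)"
proof -
  have fK: "finite K" using assms finite_I finite_subset by blast
  have "coord a I (\<Sum>k\<in>K. c k *\<^sub>R a k) i = (\<Sum>k\<in>K. coord a I (c k *\<^sub>R a k) i)"
    using assms by (intro coord_sum span_scale in_span_a) auto
  also have "\<dots> = (\<Sum>k\<in>K. if k = i then c i else 0)"
    using assms by (intro sum.cong refl) (auto simp: coord_scale in_span_a coord_a)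
  finally show ?thesis using fK by simp
qed

lemma coord_eq_0D:
  assumes "x \<in> span (a ` I)" "\<And>i. i \<in> I \<Longrightarrow> coord a I x i = 0"
  shows "x = 0"
  using coord_expand[OF assms(1)] assms(2) by simp

lemma in_span_subset_iff:
  assumes "K \<subseteq> I" "x \<in> span (a ` I)"
  shows "x \<in> span (a ` K) \<longleftrightarrow> (\<forall>i\<in>I - K. coord a I x i = 0)"
proof
  assume "x \<in> span (a ` K)"
  moreover have "x \<in> span (a ` K) \<Longrightarrow> i \<in> I - K \<Longrightarrow> representation (a ` K) x (a i) = 0" for i
  proof -
    assume i: "i \<in> I - K"
    have "a i \<notin> a ` K" using i assms(1) inj_onD[OF inj_a, of i] by blast
    then show ?thesis by (metis representation_ne_zero)
  qed
  moreover have "x \<in> span (a ` K) \<Longrightarrow> representation (a ` I) x = representation (a ` K) x"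
    by (rule representation_extend[OF indep_a]) (use assms in auto)
  ultimately show "\<forall>i\<in>I - K. coord a I x i = 0" by (simp add: coord_def)
next
  assume *: "\<forall>i\<in>I - K. coord a I x i = 0"
  have "x = (\<Sum>i\<in>I. coord a I x i *\<^sub>R a i)" using coord_expand[OF assms(2)] by simp
  also have "\<dots> = (\<Sum>i\<in>K. coord a I x i *\<^sub>R a i)"
    using assms(1) finite_I * by (intro sum.mono_neutral_right) auto
  finally show "x \<in> span (a ` K)" by (metis (no_types, lifting) imageI span_base span_scale span_sum)
qed

lemma coord_subset:
  assumes "K \<subseteq> I" "x \<in> span (a ` K)"
  shows "coord a K x i = coord a I x i"
  using representation_extend[OF indep_a assms(2)] assms(1)
  by (simp add: coord_def image_mono)

lemma nonneg_comb_iff: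
  assumes "x \<in> span (a ` I)"
  shows "nonneg_comb a I x \<longleftrightarrow> (\<forall>i\<in>I. 0 \<le> coord a I x i)"
proof
  assume "nonneg_comb a I x"
  then show "\<forall>i\<in>I. 0 \<le> coord a I x i"
    unfolding nonneg_comb_def by (auto simp: coord_comb)
next
  assume "\<forall>i\<in>I. 0 \<le> coord a I x i"
  then show "nonneg_comb a I x"
    unfolding nonneg_comb_def using coord_expand[OF assms] by metis
qed

lemma involves_iff: "involves a I x i \<longleftrightarrow> coord a I x i \<noteq> 0"
  by (simp add: involves_def coord_def)

lemma subbasis: "K \<subseteq> I \<Longrightarrow> indexed_basis a K"
  using finite_I inj_a indep_a
  by (metis finite_subset image_mono independent_mono indexed_basis.intro inj_on_subset)

lemma part_split:
  assumes "x \<in> span (a ` I)" "I = K \<union> L" "K \<inter> L = {}"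
  shows "simple_part a I K x + simple_part a I L x = x"
  using coord_expand[OF assms(1)] assms(2,3) finite_I
  by (simp add: simple_part_def sum.union_disjoint)

end


section \<open>The product of commuting simple reflections\<close>

definition refl_prod :: "('i \<Rightarrow> 'v::real_inner) \<Rightarrow> 'i set \<Rightarrow> 'v \<Rightarrow> 'v" where
  "refl_prod a K x = x - (\<Sum>i\<in>K. (2 * (x \<bullet> a i) / (a i \<bullet> a i)) *\<^sub>R a i)"

definition pairwise_orthogonal :: "('i \<Rightarrow> 'v::real_inner) \<Rightarrow> 'i set \<Rightarrow> bool" where
  "pairwise_orthogonal a K \<longleftrightarrow> (\<forall>i\<in>K. \<forall>j\<in>K. i \<noteq> j \<longrightarrow> a i \<bullet> a j = 0)"

lemma refl_along_commute:
  assumes "x \<bullet> y = 0"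
  shows "refl_along x \<circ> refl_along y = refl_along y \<circ> refl_along x"
proof
  fix z
  have "y \<bullet> x = 0" using assms by (simp add: inner_commute)
  then show "(refl_along x \<circ> refl_along y) z = (refl_along y \<circ> refl_along x) z"
    using assms by (simp add: refl_along_def inner_diff_left)
qed

lemma comp_fun_commute_refl_along:
  assumes "pairwise_orthogonal a K"
  shows "comp_fun_commute_on K (\<lambda>i. refl_along (a i))"
proof
  fix i j assume "i \<in> K" "j \<in> K"
  then show "refl_along (a j) \<circ> refl_along (a i) = refl_along (a i) \<circ> refl_along (a j)"
    using assms refl_along_commute[of "a j" "a i"]
    by (cases "i = j") (auto simp: pairwise_orthogonal_def)
qed

text \<open>
Simple reflections along pairwise orthogonal roots leave each other's coefficients unchanged, so
their product has a closed formula, linear in its argument.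
\<close>

lemma fold_refl_along:
  assumes "finite K" "pairwise_orthogonal a K"
  shows "Finite_Set.fold (\<lambda>i. refl_along (a i)) x K = refl_prod a K x"
proof -
  interpret comp_fun_commute_on K "\<lambda>i. refl_along (a i)"
    by (rule comp_fun_commute_refl_along[OF assms(2)])
  have "L \<subseteq> K \<longrightarrow> Finite_Set.fold (\<lambda>i. refl_along (a i)) x L = refl_prod a L x" if "finite L" for L
    using that
  proof (induction L)
    case empty then show ?case by (simp add: refl_prod_def)
  next
    case (insert i L)
    show ?case
    proof
      assume sub: "insert i L \<subseteq> K"
      have "a j \<bullet> a i = 0" if "j \<in> L" for j
      proof -
        have "i \<in> K" "j \<in> K" "j \<noteq> i" using that insert.hyps(2) sub by auto
        then show ?thesis using assms(2) by (simp add: pairwise_orthogonal_def)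
      qed
      then have "(\<Sum>j\<in>L. (2 * (x \<bullet> a j) / (a j \<bullet> a j)) * (a j \<bullet> a i)) = 0"
        by (intro sum.neutral) simp
      then have "refl_prod a L x \<bullet> a i = x \<bullet> a i"
        by (simp add: refl_prod_def inner_diff_left inner_sum_left)
      moreover have "Finite_Set.fold (\<lambda>i. refl_along (a i)) x (insert i L) = refl_along (a i) (refl_prod a L x)"
        using insert sub by (subst fold_insert) auto
      ultimately show "Finite_Set.fold (\<lambda>i. refl_along (a i)) x (insert i L) = refl_prod a (insert i L) x"
        using insert.hyps by (simp only: refl_along_def) (simp add: refl_prod_def)
    qed
  qed
  then show ?thesis using assms(1) by blast
qed

lemma refl_prod_closed:
  assumes "finite K" "pairwise_orthogonal a K" "\<And>i. i \<in> K \<Longrightarrow> refl_along (a i) ` S \<subseteq> S" "x \<in> S"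
  shows "refl_prod a K x \<in> S"
proof -
  interpret comp_fun_commute_on K "\<lambda>i. refl_along (a i)"
    by (rule comp_fun_commute_refl_along[OF assms(2)])
  have "L \<subseteq> K \<longrightarrow> Finite_Set.fold (\<lambda>i. refl_along (a i)) x L \<in> S" if "finite L" for L
    using that
  proof (induction L)
    case (insert i L)
    then show ?case using assms(3)[of i] by auto
  qed (use assms in auto)
  then show ?thesis using fold_refl_along[OF assms(1,2)] assms(1) by (metis subset_refl)
qed

lemma refl_prod_linear: "linear (refl_prod a K)"
proof (rule linearI)
  show "refl_prod a K (x + y) = refl_prod a K x + refl_prod a K y" for x y
  proof -
    have "(\<Sum>i\<in>K. (2 * ((x + y) \<bullet> a i) / (a i \<bullet> a i)) *\<^sub>R a i) =
        (\<Sum>i\<in>K. (2 * (x \<bullet> a i) / (a i \<bullet> a i)) *\<^sub>R a i +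
          (2 * (y \<bullet> a i) / (a i \<bullet> a i)) *\<^sub>R a i)"
      by (intro sum.cong refl, simp only: inner_add_left distrib_left add_divide_distrib scaleR_add_left)
    then show ?thesis unfolding refl_prod_def by (simp only: sum.distrib) simp
  qed
  show "refl_prod a K (r *\<^sub>R x) = r *\<^sub>R refl_prod a K x" for r x
  proof -
    have "(\<Sum>i\<in>K. (2 * ((r *\<^sub>R x) \<bullet> a i) / (a i \<bullet> a i)) *\<^sub>R a i) =
        r *\<^sub>R (\<Sum>i\<in>K. (2 * (x \<bullet> a i) / (a i \<bullet> a i)) *\<^sub>R a i)"
      unfolding scaleR_sum_right by (intro sum.cong refl) simp
    then show ?thesis unfolding refl_prod_def by (simp only: scaleR_diff_right)
  qed
qed

lemma refl_prod_minus: "refl_prod a K (- x) = - refl_prod a K x"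
  by (simp add: linear_neg[OF refl_prod_linear])

lemma refl_prod_reverses:
  assumes "finite K" "pairwise_orthogonal a K" "i \<in> K"
  shows "refl_prod a K x \<bullet> a i = - (x \<bullet> a i)"
proof (cases "a i = 0")
  case False
  have "(\<Sum>j\<in>K. (2 * (x \<bullet> a j) / (a j \<bullet> a j)) * (a j \<bullet> a i)) =
        (\<Sum>j\<in>K. if j = i then 2 * (x \<bullet> a i) else 0)"
    using assms False by (intro sum.cong refl) (auto simp: pairwise_orthogonal_def)
  then show ?thesis using assms
    by (simp add: refl_prod_def inner_diff_left inner_sum_left)
qed auto

lemma refl_prod_a:
  assumes "finite K" "pairwise_orthogonal a K" "i \<in> K" "a i \<noteq> 0"
  shows "refl_prod a K (a i) = - a i"
proof -
  have "(\<Sum>j\<in>K. (2 * (a i \<bullet> a j) / (a j \<bullet> a j)) *\<^sub>R a j) = (\<Sum>j\<in>K. if j = i then 2 *\<^sub>R a i else 0)"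
    using assms by (intro sum.cong refl) (auto simp: pairwise_orthogonal_def)
  then show ?thesis using assms by (simp add: refl_prod_def scaleR_2)
qed


section \<open>The Euler form\<close>

text \<open>
The part of the symmetric form between \<open>P\<close> and \<open>N\<close> is put entirely into one of the two orders of the
arguments, and the part inside \<open>P\<close> and inside \<open>N\<close> is shared equally; hence the symmetrization of
this form is the inner product on the span of the simple roots.
\<close>

definition euler :: "('i \<Rightarrow> 'v::real_inner) \<Rightarrow> 'i set \<Rightarrow> 'i set \<Rightarrow> 'v \<Rightarrow> 'v \<Rightarrow> real" where
  "euler a P N x y =
     (let p = simple_part a (P \<union> N) P; n = simple_part a (P \<union> N) N in
      (p x \<bullet> p y) / 2 + (n x \<bullet> n y) / 2 + n x \<bullet> p y)"

definition bicoxeter :: "('i \<Rightarrow> 'v::real_inner) \<Rightarrow> 'i set \<Rightarrow> 'i set \<Rightarrow> 'v \<Rightarrow> 'v" where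
  "bicoxeter a P N x = refl_prod a N (refl_prod a P x)"

text \<open>
The roots \<open>proj_root a P i\<close> are the positive roots which the bicoxeter element makes negative; in the
crystallographic case they are the classes of the indecomposable projective representations, and
\<open>inj_root a N i\<close> those of the injective ones.
\<close>

definition proj_root :: "('i \<Rightarrow> 'v::real_inner) \<Rightarrow> 'i set \<Rightarrow> 'i \<Rightarrow> 'v" where
  "proj_root a P i = (if i \<in> P then a i else refl_prod a P (a i))"

definition inj_root :: "('i \<Rightarrow> 'v::real_inner) \<Rightarrow> 'i set \<Rightarrow> 'i \<Rightarrow> 'v" where
  "inj_root a N i = (if i \<in> N then a i else refl_prod a N (a i))"

locale bipartite_basis = indexed_basis a "P \<union> N" for a :: "'i \<Rightarrow> 'v::real_inner" and P N +
  assumes disjoint_PN: "P \<inter> N = {}"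
    and orth_P: "pairwise_orthogonal a P" and orth_N: "pairwise_orthogonal a N"
begin

abbreviation "I \<equiv> P \<union> N"
abbreviation "V \<equiv> span (a ` (P \<union> N))"
abbreviation "E \<equiv> euler a P N"
abbreviation "sP \<equiv> refl_prod a P"
abbreviation "sN \<equiv> refl_prod a N"
abbreviation "c \<equiv> bicoxeter a P N"
abbreviation "co \<equiv> coord a (P \<union> N)"
abbreviation "Pr \<equiv> proj_root a P"
abbreviation "In \<equiv> inj_root a N"

lemma finite_P: "finite P" and finite_N: "finite N"
  using finite_I by auto

lemma a_nonzero: "i \<in> I \<Longrightarrow> a i \<noteq> 0"
  using indep_a dependent_zero by (metis imageI)

lemma refl_prod_in_V: "K \<subseteq> I \<Longrightarrow> x \<in> V \<Longrightarrow> refl_prod a K x \<in> V"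
  unfolding refl_prod_def by (intro span_diff comb_in_span)

lemma coord_refl_prod:
  assumes "K \<subseteq> I" "x \<in> V" "i \<in> I"
  shows "co (refl_prod a K x) i = co x i - (if i \<in> K then 2 * (x \<bullet> a i) / (a i \<bullet> a i) else 0)"
  unfolding refl_prod_def using assms
  by (simp add: coord_diff comb_in_span coord_comb)

lemma part_refl_prod:
  assumes "x \<in> V" "K \<subseteq> I" "L \<subseteq> I" "K \<inter> L = {}"
  shows "simple_part a I L (refl_prod a K x) = simple_part a I L x"
  unfolding simple_part_def using assms by (intro sum.cong refl) (auto simp: coord_refl_prod subset_iff)

text \<open>
On the span of the roots in \<open>K\<close> the product of their reflections is \<open>-1\<close>; this reads off the
\<open>K\<close>-part of a reflected vector, which its coordinates give only through a projection.
\<close>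

lemma refl_prod_reverses_part:
  assumes "K \<subseteq> I" "pairwise_orthogonal a K"
  shows "refl_prod a K x \<bullet> simple_part a I K y = - (x \<bullet> simple_part a I K y)"
  using assms finite_subset[OF assms(1) finite_I]
  by (simp add: simple_part_def inner_sum_right refl_prod_reverses sum_negf)

lemma inner_split:
  assumes "x \<in> V"
  shows "x \<bullet> z = simple_part a I P x \<bullet> z + simple_part a I N x \<bullet> z"
  using part_split[OF assms refl disjoint_PN] by (metis inner_add_left)

text \<open>
Half of the bicoxeter element turns the Euler form into the symmetric and split form
\<open>(y\<^sub>P \<bullet> u\<^sub>P - y\<^sub>N \<bullet> u\<^sub>N) / 2\<close>. The other half does the same in the first argument with the opposite sign,
and comparing the two gives \<open>euler_serre\<close>.
\<close>

lemma euler_refl_N: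
  assumes "u \<in> V" "y \<in> V"
  shows "E y (sN u) = (simple_part a I P y \<bullet> simple_part a I P u) / 2 - (simple_part a I N y \<bullet> simple_part a I N u) / 2"
proof -
  define w where "w = sN u"
  have wV: "w \<in> V" unfolding w_def using assms by (intro refl_prod_in_V) auto
  have P: "simple_part a I P w = simple_part a I P u"
    unfolding w_def using assms disjoint_PN by (intro part_refl_prod) auto
  have "w \<bullet> simple_part a I N y = - (u \<bullet> simple_part a I N y)"
    unfolding w_def by (rule refl_prod_reverses_part[OF _ orth_N]) auto
  then have "simple_part a I P u \<bullet> simple_part a I N y + simple_part a I N w \<bullet> simple_part a I N y =
      - (simple_part a I P u \<bullet> simple_part a I N y) - simple_part a I N u \<bullet> simple_part a I N y"
    using inner_split[OF wV] inner_split[OF assms(1)] P by simp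
  then show ?thesis
    unfolding euler_def Let_def w_def[symmetric] P by (simp add: inner_commute field_simps)
qed

lemma euler_refl_P:
  assumes "x \<in> V" "y \<in> V"
  shows "E x y = (simple_part a I N (sP x) \<bullet> simple_part a I N y) / 2 - (simple_part a I P (sP x) \<bullet> simple_part a I P y) / 2"
proof -
  define w where "w = sP x"
  have wV: "w \<in> V" unfolding w_def using assms by (intro refl_prod_in_V) auto
  have N: "simple_part a I N w = simple_part a I N x"
    unfolding w_def using assms disjoint_PN by (intro part_refl_prod) auto
  have "w \<bullet> simple_part a I P y = - (x \<bullet> simple_part a I P y)"
    unfolding w_def by (rule refl_prod_reverses_part[OF _ orth_P]) auto
  then have "simple_part a I P w \<bullet> simple_part a I P y + simple_part a I N x \<bullet> simple_part a I P y =
      - (simple_part a I P x \<bullet> simple_part a I P y) - simple_part a I N x \<bullet> simple_part a I P y"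
    using inner_split[OF wV] inner_split[OF assms(1)] N by simp
  then show ?thesis
    unfolding euler_def Let_def w_def[symmetric] N by (simp add: inner_commute field_simps)
qed

lemma c_in_V: "x \<in> V \<Longrightarrow> c x \<in> V"
  unfolding bicoxeter_def by (intro refl_prod_in_V) auto

lemma c_linear: "linear c"
  unfolding bicoxeter_def
  using linear_compose[OF refl_prod_linear refl_prod_linear] by (simp add: o_def)

text \<open>
The analogue of Auslander-Reiten duality. Applied twice it gives invariance under \<open>c\<close>; applied to a
fixed vector \<open>x\<close> it gives \<open>E x x = - E x x\<close>, where \<open>E x x\<close> is half the squared norm.
\<close>

lemma euler_serre:
  assumes "x \<in> V" "y \<in> V"
  shows "E y (c x) = - E x y"
proof -
  have "sP x \<in> V" using assms by (intro refl_prod_in_V) auto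
  then show ?thesis
    unfolding bicoxeter_def using euler_refl_N[OF _ assms(2)] euler_refl_P[OF assms]
    by (simp add: inner_commute)
qed

lemma euler_c_invariant: "x \<in> V \<Longrightarrow> y \<in> V \<Longrightarrow> E (c x) (c y) = E x y"
  by (simp add: euler_serre c_in_V)

lemma euler_self: 
  assumes "x \<in> V"
  shows "E x x = (x \<bullet> x) / 2"
proof -
  have "x \<bullet> x = (p + n) \<bullet> (p + n)" if "p = simple_part a I P x" "n = simple_part a I N x" for p n
    using part_split[OF assms refl disjoint_PN] that by simp
  then show ?thesis
    by (simp add: euler_def Let_def inner_add_left inner_add_right inner_commute)
qed

lemma c_fixed_zero:
  assumes "x \<in> V" "c x = x"
  shows "x = 0"
  using euler_serre[OF assms(1,1)] assms by (simp add: euler_self)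

lemma c_eq_0D:
  assumes "x \<in> V" "c x = 0"
  shows "x = 0"
proof -
  have "E x 0 = 0" by (simp add: euler_def Let_def simple_part_def coord_def representation_zero)
  then show ?thesis using euler_serre[OF assms(1,1)] assms(2) euler_self[OF assms(1)] by simp
qed

lemma c_inj: "x \<in> V \<Longrightarrow> y \<in> V \<Longrightarrow> c x = c y \<Longrightarrow> x = y"
  using c_eq_0D[of "x - y"] by (simp add: linear_diff[OF c_linear] span_diff)

lemma c_pow_in_V: "x \<in> V \<Longrightarrow> (c ^^ n) x \<in> V"
  by (induction n) (auto simp: c_in_V)

lemma euler_c_pow: "x \<in> V \<Longrightarrow> y \<in> V \<Longrightarrow> E ((c ^^ n) x) ((c ^^ n) y) = E x y"
  by (induction n) (auto simp: c_pow_in_V euler_c_invariant)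

lemma proj_in_V: "i \<in> I \<Longrightarrow> Pr i \<in> V"
  unfolding proj_root_def by (auto intro!: refl_prod_in_V in_span_a)

lemma inj_in_V: "i \<in> I \<Longrightarrow> In i \<in> V"
  unfolding inj_root_def by (auto intro!: refl_prod_in_V in_span_a)

lemma c_proj: 
  assumes "i \<in> I" 
  shows "c (Pr i) = - In i"
proof -
  have inv: "sP (sP (a i)) = a i" if "i \<in> N"
  proof -
    have "(\<Sum>j\<in>P. (2 * (sP (a i) \<bullet> a j) / (a j \<bullet> a j)) *\<^sub>R a j)
        = - (\<Sum>j\<in>P. (2 * (a i \<bullet> a j) / (a j \<bullet> a j)) *\<^sub>R a j)"
      using refl_prod_reverses[OF finite_P orth_P] by (simp add: sum_negf[symmetric] cong: sum.cong)
    then show ?thesis by (subst refl_prod_def) (simp add: refl_prod_def)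
  qed
  show ?thesis
  proof (cases "i \<in> P")
    case True
    then have "i \<notin> N" using disjoint_PN by auto
    with True show ?thesis
      using refl_prod_a[OF finite_P orth_P True] a_nonzero
      by (simp add: proj_root_def inj_root_def bicoxeter_def refl_prod_minus)
  next
    case False
    then have "i \<in> N" using assms by auto
    with False inv show ?thesis
      using refl_prod_a[OF finite_N orth_N, of i] a_nonzero
      by (simp add: proj_root_def inj_root_def bicoxeter_def refl_prod_minus)
  qed
qed

lemma part_a:
  assumes "i \<in> I" "K \<subseteq> I"
  shows "simple_part a I K (a i) = (if i \<in> K then a i else 0)"
proof -
  have "finite K" using assms finite_I finite_subset by blast
  have "simple_part a I K (a i) = (\<Sum>j\<in>K. if j = i then a i else 0)"
    unfolding simple_part_def using assms by (intro sum.cong refl) (auto simp: coord_a)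
  with \<open>finite K\<close> show ?thesis by simp
qed

lemma part_inner_a:
  assumes "finite K" "pairwise_orthogonal a K" "i \<in> K"
  shows "simple_part a I K y \<bullet> a i = co y i * (a i \<bullet> a i)"
proof -
  have "(\<Sum>j\<in>K. co y j * (a j \<bullet> a i)) = (\<Sum>j\<in>K. if j = i then co y i * (a i \<bullet> a i) else 0)"
    using assms by (intro sum.cong refl) (auto simp: pairwise_orthogonal_def)
  then show ?thesis using assms by (simp add: simple_part_def inner_sum_left)
qed

lemma euler_inj:
  assumes "i \<in> I" "y \<in> V"
  shows "E y (In i) = co y i * (a i \<bullet> a i) / 2"
proof (cases "i \<in> N")
  case True
  then have "i \<notin> P" using disjoint_PN by auto
  with True show ?thesis
    using part_inner_a[OF finite_N orth_N True, of y] 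
    by (simp add: inj_root_def euler_def part_a inner_commute)
next
  case False
  then have "i \<in> P" using assms by auto
  with False show ?thesis
    using part_inner_a[OF finite_P orth_P \<open>i \<in> P\<close>, of y] euler_refl_N[OF in_span_a assms(2)]
    by (simp add: inj_root_def part_a inner_commute)
qed

lemma part_minus: "x \<in> V \<Longrightarrow> simple_part a I K (- x) = - simple_part a I K x"
  by (simp add: simple_part_def coord_minus sum_negf)

lemma euler_minus_right: "y \<in> V \<Longrightarrow> E x (- y) = - E x y"
  by (simp add: euler_def Let_def part_minus)

lemma euler_minus_left: "x \<in> V \<Longrightarrow> E (- x) y = - E x y"
  by (simp add: euler_def Let_def part_minus)

lemma euler_proj:
  assumes "i \<in> I" "y \<in> V"
  shows "E (Pr i) y = co y i * (a i \<bullet> a i) / 2"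
  using euler_serre[OF proj_in_V[OF assms(1)] assms(2)] euler_inj[OF assms]
  by (simp add: c_proj[OF assms(1)] euler_minus_right[OF inj_in_V[OF assms(1)]])

end

section \<open>Root systems with a bipartite base\<close>

lemma roots_in_span:
  assumes "simple_roots \<Phi> a I"
  shows "\<Phi> \<subseteq> span (a ` I)"
proof
  fix x assume "x \<in> \<Phi>"
  moreover have "y \<in> span (a ` I)" if "nonneg_comb a I y" for y
    using that unfolding nonneg_comb_def
    by clarify (intro span_sum span_scale span_base imageI)
  ultimately show "x \<in> span (a ` I)"
    using assms span_neg unfolding simple_roots_def by (metis minus_minus)
qed

lemma indexed_basis_simple_roots:
  assumes "root_system \<Phi>" "simple_roots \<Phi> a I"
  shows "indexed_basis a I"
proof
  have "finite (a ` I)"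
    using assms unfolding root_system_def simple_roots_def by (meson finite_subset)
  then show "finite I"
    using assms unfolding simple_roots_def by (meson finite_imageD)
qed (use assms in \<open>auto simp: simple_roots_def\<close>)

text \<open>
If the reflections in two independent vectors commute, then applying both of their products to one of
the vectors and comparing coefficients forces the inner product to vanish.
\<close>

lemma pairwise_orthogonal_totally_disconnected:
  assumes "indexed_basis a I" "K \<subseteq> I" "totally_disconnected a K"
  shows "pairwise_orthogonal a K"
  unfolding pairwise_orthogonal_def
proof (intro ballI impI)
  interpret indexed_basis a I by fact
  fix i j assume ij: "i \<in> K" "j \<in> K" "i \<noteq> j"
  have ijI: "i \<in> I" "j \<in> I" using ij assms(2) by auto
  have "refl_along (a i) \<circ> refl_along (a j) = refl_along (a j) \<circ> refl_along (a i)"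
    using assms(3) ij unfolding totally_disconnected_def coxeter_edge_def by blast
  then have comm: "refl_along (a i) (refl_along (a j) (a j)) = refl_along (a j) (refl_along (a i) (a j))"
    by (metis comp_apply)
  have nz: "a j \<noteq> 0" "a i \<noteq> 0" using ijI indep_a dependent_zero by (metis imageI)+
  define r where "r = 2 * (a j \<bullet> a i) / (a i \<bullet> a i)"
  define s where "s = 2 * (a i \<bullet> a j) / (a j \<bullet> a j)"
  have l: "refl_along (a i) (refl_along (a j) (a j)) = r *\<^sub>R a i - a j"
    using nz by (simp add: refl_along_def r_def scaleR_2 inner_diff_left)
  have "refl_along (a j) (refl_along (a i) (a j)) =
      (a j - r *\<^sub>R a i) - (2 * ((a j - r *\<^sub>R a i) \<bullet> a j) / (a j \<bullet> a j)) *\<^sub>R a j"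
    by (simp add: refl_along_def r_def)
  also have "2 * ((a j - r *\<^sub>R a i) \<bullet> a j) / (a j \<bullet> a j) = 2 - r * s"
    using nz by (simp add: inner_diff_left s_def field_simps)
  finally have rr: "refl_along (a j) (refl_along (a i) (a j)) = (a j - r *\<^sub>R a i) - (2 - r * s) *\<^sub>R a j" .
  have "coord a I (r *\<^sub>R a i - a j) i = coord a I ((a j - r *\<^sub>R a i) - (2 - r * s) *\<^sub>R a j) i"
    using comm l rr by simp
  moreover have "coord a I (r *\<^sub>R a i - a j) i = r"
    using ijI ij(3) by (simp add: coord_diff coord_scale span_scale in_span_a coord_a)
  moreover have "coord a I ((a j - r *\<^sub>R a i) - (2 - r * s) *\<^sub>R a j) i = - r"
    using ijI ij(3) by (simp add: coord_diff coord_scale span_scale span_diff in_span_a coord_a)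
  ultimately have "r = 0" by simp
  then show "a i \<bullet> a j = 0" using nz by (simp add: r_def inner_commute)
qed

locale bipartite_root_system =
  fixes \<Phi> :: "'v::real_inner set" and a :: "'i \<Rightarrow> 'v" and P N :: "'i set"
  assumes roots: "root_system \<Phi>" and simple: "simple_roots \<Phi> a (P \<union> N)"
    and disjoint: "P \<inter> N = {}"
    and td_P: "totally_disconnected a P" and td_N: "totally_disconnected a N"

sublocale bipartite_root_system \<subseteq> bipartite_basis a P N
proof -
  interpret indexed_basis a "P \<union> N" by (rule indexed_basis_simple_roots[OF roots simple])
  show "bipartite_basis a P N"
    using disjoint pairwise_orthogonal_totally_disconnected[OF indexed_basis_axioms _ td_P]
      pairwise_orthogonal_totally_disconnected[OF indexed_basis_axioms _ td_N]
    by unfold_locales auto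
qed

context bipartite_root_system
begin

abbreviation "pos \<equiv> pos_roots \<Phi> a (P \<union> N)"
abbreviation "AP \<equiv> almost_pos_roots \<Phi> a (P \<union> N)"
abbreviation "R \<equiv> rot a P N"
abbreviation "dp \<equiv> depth \<Phi> a P N"

lemma root_in_V: "x \<in> \<Phi> \<Longrightarrow> x \<in> V"
  using roots_in_span[OF simple] by blast

lemma pos_iff: "x \<in> pos \<longleftrightarrow> x \<in> \<Phi> \<and> (\<forall>i\<in>I. 0 \<le> co x i)"
  unfolding pos_roots_def using nonneg_comb_iff[OF root_in_V] by auto

lemma pos_root: "x \<in> pos \<Longrightarrow> x \<in> \<Phi>"
  by (simp add: pos_roots_def)

lemma pos_in_V: "x \<in> pos \<Longrightarrow> x \<in> V"
  by (simp add: pos_root root_in_V)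

lemma root_nonzero: "x \<in> \<Phi> \<Longrightarrow> x \<noteq> 0"
  using roots by (auto simp: root_system_def)

lemma root_line: "x \<in> \<Phi> \<Longrightarrow> \<Phi> \<inter> span {x} = {x, - x}"
  using roots by (auto simp: root_system_def)

lemma neg_root: "x \<in> \<Phi> \<Longrightarrow> - x \<in> \<Phi>"
  using root_line by blast

lemma root_cases: "x \<in> \<Phi> \<Longrightarrow> x \<in> pos \<or> - x \<in> pos"
  using simple neg_root unfolding simple_roots_def pos_roots_def by blast

lemma pos_not_neg: 
  assumes "x \<in> pos" 
  shows "- x \<notin> pos"
proof
  assume "- x \<in> pos"
  then have "co x i = 0" if "i \<in> I" for i
    using that assms coord_minus[OF pos_in_V[OF assms]] by (force simp: pos_iff)
  then have "x = 0" using coord_eq_0D[OF pos_in_V[OF assms]] by blast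
  then show False using root_nonzero pos_root assms by blast
qed

lemma simple_pos: "i \<in> I \<Longrightarrow> a i \<in> pos"
  using simple by (auto simp: pos_iff coord_a simple_roots_def)

lemma pos_not_neg_simple: "x \<in> pos \<Longrightarrow> i \<in> I \<Longrightarrow> x \<noteq> - a i"
  using pos_not_neg[OF simple_pos] by blast

lemma sign_coherent:
  assumes "x \<in> \<Phi>" "i \<in> I" "0 < co x i"
  shows "x \<in> pos"
proof (rule ccontr)
  assume "x \<notin> pos"
  then have "0 \<le> co (- x) i" using root_cases[OF assms(1)] assms(2) pos_iff by blast
  then show False using assms coord_minus[OF root_in_V[OF assms(1)]] by simp
qed

lemma refl_prod_root:
  assumes "K \<subseteq> I" "pairwise_orthogonal a K" "x \<in> \<Phi>"
  shows "refl_prod a K x \<in> \<Phi>"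
proof (rule refl_prod_closed)
  show "finite K" using assms(1) finite_I finite_subset by blast
  fix i assume "i \<in> K"
  then have "a i \<in> \<Phi>" using assms(1) simple by (auto simp: simple_roots_def)
  then show "refl_along (a i) ` \<Phi> \<subseteq> \<Phi>" using roots by (simp add: root_system_def)
qed (use assms in auto)

text \<open>
A coefficient outside \<open>K\<close> is unchanged, so a positive one there keeps the root positive. A positive
root supported in \<open>K\<close> must be simple: a single reflection \<open>s\<^sub>i\<close> with \<open>i\<close> in its support negates the
\<open>i\<close>-th coefficient and leaves the others alone, as the roots of \<open>K\<close> are orthogonal, so coherence of
signs leaves no other coefficient.
\<close>

lemma refl_prod_pos:
  assumes K: "K \<subseteq> I" "pairwise_orthogonal a K" and x: "x \<in> pos" "x \<notin> a ` K"
  shows "refl_prod a K x \<in> pos"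
proof (cases "\<exists>i\<in>I - K. co x i \<noteq> 0")
  case True
  then obtain i where i: "i \<in> I" "i \<notin> K" "co x i \<noteq> 0" by blast
  then have "0 < co x i" using x(1) pos_iff by (metis less_eq_real_def)
  then have "0 < co (refl_prod a K x) i"
    using coord_refl_prod[OF K(1) pos_in_V[OF x(1)] i(1)] i(2) by simp
  then show ?thesis by (rule sign_coherent[OF refl_prod_root[OF K pos_root[OF x(1)]] i(1)])
next
  case False
  have xV: "x \<in> V" using x(1) by (rule pos_in_V)
  have fK: "finite K" using K(1) finite_I finite_subset by blast
  obtain i where i: "i \<in> I" "co x i \<noteq> 0"
    using coord_eq_0D[OF xV] root_nonzero[OF pos_root[OF x(1)]] by blast
  then have iK: "i \<in> K" using False by blast
  have ci: "0 < co x i" using i x(1) pos_iff by (metis less_eq_real_def)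
  have "x = simple_part a I K x"
    unfolding simple_part_def
    by (subst coord_expand[OF xV, symmetric], rule sum.mono_neutral_right) (use K(1) finite_I False in auto)
  then have xi: "x \<bullet> a i = co x i * (a i \<bullet> a i)"
    using part_inner_a[OF fK K(2) iK, of x] by simp
  define y where "y = refl_prod a {i} x"
  have y: "y \<in> \<Phi>" unfolding y_def
    by (rule refl_prod_root) (use i x(1) pos_root in \<open>auto simp: pairwise_orthogonal_def\<close>)
  have cy: "co y j = (if j = i then - co x i else co x j)" if "j \<in> I" for j
    unfolding y_def using coord_refl_prod[OF _ xV that, of "{i}"] i(1) a_nonzero[OF i(1)] xi by simp
  have "\<not> 0 \<le> co y i" using cy[OF i(1)] ci by simp
  then have "y \<notin> pos" using i(1) pos_iff by blast
  then have my: "- y \<in> pos" using root_cases[OF y] by blast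
  have "co x j = 0" if j: "j \<in> I" "j \<noteq> i" for j
  proof -
    have "0 \<le> co (- y) j" using my j(1) pos_iff by blast
    then have "co x j \<le> 0" using cy[OF j(1)] j(2) coord_minus[OF root_in_V[OF y]] by simp
    moreover have "0 \<le> co x j" using x(1) j(1) pos_iff by blast
    ultimately show ?thesis by simp
  qed
  then have "x \<in> span (a ` {i})"
    using in_span_subset_iff[OF _ xV, of "{i}"] i(1) by auto
  then have "x \<in> \<Phi> \<inter> span {a i}" using pos_root[OF x(1)] by simp
  then have "x = a i \<or> x = - a i" using root_line[OF pos_root[OF simple_pos[OF i(1)]]] by blast
  then have False using x(2) iK pos_not_neg_simple[OF x(1) i(1)] by blast
  then show ?thesis ..
qed


section \<open>The rotation on almost positive roots\<close>

lemma tau_PN: "tau a P N x = (if \<exists>i\<in>N. x = - a i then x else sP x)"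
  unfolding tau_def using fold_refl_along[OF finite_P orth_P, of x] by simp

lemma tau_NP: "tau a N P x = (if \<exists>i\<in>P. x = - a i then x else sN x)"
  unfolding tau_def using fold_refl_along[OF finite_N orth_N, of x] by simp

lemma inj_pos: 
  assumes "i \<in> I" 
  shows "In i \<in> pos"
proof (cases "i \<in> N")
  case True then show ?thesis using assms simple_pos by (simp add: inj_root_def)
next
  case False
  then have "a i \<notin> a ` N" using assms inj_onD[OF inj_a, of i] by auto
  then have "sN (a i) \<in> pos" by (intro refl_prod_pos orth_N simple_pos assms) auto
  then show ?thesis using False by (simp add: inj_root_def)
qed

lemma proj_pos: 
  assumes "i \<in> I" 
  shows "Pr i \<in> pos"
proof (cases "i \<in> P")
  case True then show ?thesis using assms simple_pos by (simp add: proj_root_def)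
next
  case False
  then have "a i \<notin> a ` P" using assms inj_onD[OF inj_a, of i] by auto
  then have "sP (a i) \<in> pos" by (intro refl_prod_pos orth_P simple_pos assms) auto
  then show ?thesis using False by (simp add: proj_root_def)
qed

lemma rot_neg_simple:
  assumes "i \<in> I"
  shows "R (- a i) = In i"
proof (cases "i \<in> P")
  case True
  then have iN: "i \<notin> N" using disjoint by auto
  then have "\<not> (\<exists>j\<in>N. - a i = - a j)" using assms inj_onD[OF inj_a, of i] by auto
  then have "tau a P N (- a i) = a i"
    using refl_prod_a[OF finite_P orth_P True a_nonzero[OF assms]]
    by (simp add: tau_PN refl_prod_minus)
  moreover have "\<not> (\<exists>j\<in>P. a i = - a j)" using pos_not_neg_simple[OF simple_pos[OF assms]] by auto
  ultimately show ?thesis using iN by (simp add: rot_def tau_NP inj_root_def)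
next
  case False
  then have iN: "i \<in> N" using assms by auto
  then have "tau a P N (- a i) = - a i" by (auto simp: tau_PN)
  moreover have "\<not> (\<exists>j\<in>P. - a i = - a j)" using False assms inj_onD[OF inj_a, of i] by auto
  ultimately show ?thesis
    using iN refl_prod_a[OF finite_N orth_N iN a_nonzero[OF assms]]
    by (simp add: rot_def tau_NP inj_root_def refl_prod_minus)
qed

text \<open>
The piecewise definition of the rotation is linear on positive roots as long as the image is positive.
The exceptions are the simple roots of \<open>P\<close>, stopped halfway as negative simple roots, and the roots
that the first half sends to a simple root of \<open>N\<close>.
\<close>

lemma rot_pos_cases:
  assumes "x \<in> pos"
  obtains (proj) i where "i \<in> I" "x = Pr i" "R x = - a i"
  | (pos) "R x = c x" "c x \<in> pos"
proof -
  have t1: "tau a P N x = sP x" using pos_not_neg_simple[OF assms] by (auto simp: tau_PN)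
  show thesis
  proof (cases "x \<in> a ` P")
    case True
    then obtain i where i: "i \<in> P" "x = a i" by blast
    then have "sP x = - a i" using refl_prod_a[OF finite_P orth_P] a_nonzero by auto
    moreover have "tau a N P (- a i) = - a i" using i(1) by (auto simp: tau_NP)
    ultimately show thesis using i t1 by (intro proj[of i]) (auto simp: proj_root_def rot_def)
  next
    case False
    then have sx: "sP x \<in> pos" by (intro refl_prod_pos orth_P assms) auto
    then have "tau a N P (sP x) = sN (sP x)" using pos_not_neg_simple[OF sx] by (auto simp: tau_NP)
    then have Rx: "R x = c x" by (simp add: rot_def t1 bicoxeter_def)
    show thesis
    proof (cases "sP x \<in> a ` N")
      case True
      then obtain j where j: "j \<in> N" "sP x = a j" by blast
      then have jP: "j \<notin> P" "j \<in> I" using disjoint by auto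
      have "tau a N P (sP x) = - a j"
        using refl_prod_a[OF finite_N orth_N j(1) a_nonzero[OF jP(2)]] j(2)
          \<open>tau a N P (sP x) = sN (sP x)\<close> by simp
      then have Rj: "R x = - a j" by (simp add: rot_def t1)
      have "c (Pr j) = - a j" using c_proj[OF jP(2)] j(1) by (simp add: inj_root_def)
      then have "x = Pr j"
        using Rj Rx c_inj[OF pos_in_V[OF assms] proj_in_V[OF jP(2)]] by simp
      then show thesis using proj Rj jP(2) by blast
    next
      case False
      then have "c x \<in> pos" unfolding bicoxeter_def by (intro refl_prod_pos orth_N sx) auto
      then show thesis using pos Rx by blast
    qed
  qed
qed

lemma AP_iff: "x \<in> AP \<longleftrightarrow> x \<in> pos \<or> (\<exists>i\<in>I. x = - a i)"
  by (auto simp: almost_pos_roots_def)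

lemma rot_AP: "x \<in> AP \<Longrightarrow> R x \<in> AP"
  unfolding AP_iff by (metis inj_pos rot_neg_simple rot_pos_cases)

text \<open>
A \<open>c\<close>-orbit of positive roots would be eventually periodic, and the sum over a period would be
fixed by \<open>c\<close>, hence zero; but positive roots have nonnegative coefficients and cannot cancel.
\<close>

lemma c_orbit_leaves_pos:
  assumes "x \<in> pos"
  shows "\<exists>n. (c ^^ n) x \<notin> pos"
proof (rule ccontr)
  assume "\<not> ?thesis"
  then have all: "(c ^^ n) x \<in> pos" for n by blast
  have "finite pos" using roots by (auto simp: root_system_def pos_roots_def)
  then have "finite (range (\<lambda>n. (c ^^ n) x))" using all by (meson finite_subset image_subsetI)
  then have "\<not> inj (\<lambda>n. (c ^^ n) x)" using finite_imageD infinite_UNIV_nat by blast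
  then obtain p q where "p \<noteq> q" "(c ^^ p) x = (c ^^ q) x" by (auto simp: inj_def)
  then obtain m n where mn: "m < n" "(c ^^ m) x = (c ^^ n) x" by (metis nat_neq_iff)
  define y where "y = (c ^^ m) x"
  define k where "k = n - m"
  have k: "0 < k" "(c ^^ k) y = y"
  proof -
    show "0 < k" using mn by (simp add: k_def)
    have "(c ^^ k) y = (c ^^ (k + m)) x" by (simp add: y_def funpow_add)
    then show "(c ^^ k) y = y" using mn by (simp add: k_def y_def)
  qed
  have ypos: "(c ^^ r) y \<in> pos" for r
    using all[of "r + m"] by (simp add: y_def funpow_add)
  define s where "s = (\<Sum>r<k. (c ^^ r) y)"
  have sV: "s \<in> V" unfolding s_def by (intro span_sum pos_in_V ypos)
  have "c s = (\<Sum>r<k. (c ^^ Suc r) y)" unfolding s_def by (simp add: linear_sum[OF c_linear])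
  also have "\<dots> = s"
    using sum.lessThan_Suc_shift[of "\<lambda>r. (c ^^ r) y" k] sum.lessThan_Suc[of "\<lambda>r. (c ^^ r) y" k] k(2)
    by (simp add: s_def)
  finally have "s = 0" using c_fixed_zero[OF sV] by blast
  have "co y i = 0" if i: "i \<in> I" for i
  proof -
    have "0 = co s i" using \<open>s = 0\<close> by (simp add: coord_def representation_zero)
    also have "\<dots> = (\<Sum>r<k. co ((c ^^ r) y) i)" unfolding s_def by (intro coord_sum pos_in_V ypos)
    finally have "(\<Sum>r<k. co ((c ^^ r) y) i) = 0" by simp
    moreover have "0 \<le> co ((c ^^ r) y) i" for r using ypos i pos_iff by blast
    ultimately have "\<forall>r\<in>{..<k}. co ((c ^^ r) y) i = 0" by (subst (asm) sum_nonneg_eq_0_iff) auto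
    then show ?thesis using k(1) by force
  qed
  moreover have "y \<in> pos" using ypos[of 0] by simp
  ultimately show False using coord_eq_0D[OF pos_in_V] root_nonzero pos_root by blast
qed

lemma depth_neg_simple: "i \<in> I \<Longrightarrow> dp (- a i) = 0"
  unfolding depth_def by (rule Least_equality) (auto simp: simple_pos)

text \<open>
Up to the step before its depth the rotation orbit of a positive root is its \<open>c\<close>-orbit, ending in
some \<open>Pr i\<close>; the next rotation gives \<open>- \<alpha>\<^sub>i\<close>.
\<close>

lemma pos_orbit:
  assumes "x \<in> pos"
  obtains e i where "i \<in> I" "dp x = Suc e"
    "\<And>n. n \<le> e \<Longrightarrow> (R ^^ n) x = (c ^^ n) x \<and> (c ^^ n) x \<in> pos"
    "(c ^^ e) x = Pr i" "(R ^^ Suc e) x = - a i"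
proof -
  define t where "t = (LEAST n. (c ^^ n) x \<notin> pos)"
  have t: "(c ^^ t) x \<notin> pos" unfolding t_def using c_orbit_leaves_pos[OF assms] by (rule LeastI_ex)
  have lt: "(c ^^ n) x \<in> pos" if "n < t" for n using that not_less_Least unfolding t_def by blast
  have "t \<noteq> 0" using t assms by (metis funpow_0)
  then obtain e where e: "t = Suc e" using not0_implies_Suc by blast
  have eq: "(R ^^ n) x = (c ^^ n) x" if "n \<le> e" for n
    using that
  proof (induction n)
    case (Suc n)
    have n: "(c ^^ n) x \<in> pos" "(c ^^ Suc n) x \<in> pos" using Suc.prems e by (auto intro!: lt simp del: funpow.simps)
    from n(1) show ?case
    proof (cases rule: rot_pos_cases)
      case (proj i)
      then have "c ((c ^^ n) x) = - In i" using c_proj by simp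
      then have "- In i \<in> pos" using n(2) by simp
      then show ?thesis using pos_not_neg[OF inj_pos[OF proj(1)]] by blast
    next
      case pos then show ?thesis using Suc by simp
    qed
  qed simp
  have "(c ^^ e) x \<in> pos" using lt e by simp
  then obtain i where i: "i \<in> I" "(c ^^ e) x = Pr i" "R ((c ^^ e) x) = - a i"
    by (cases rule: rot_pos_cases) (use t e in auto)
  then have Ri: "(R ^^ Suc e) x = - a i" using eq[of e] by simp
  have "dp x = Suc e"
    unfolding depth_def
  proof (rule Least_equality)
    show "- (R ^^ Suc e) x \<in> pos" using Ri simple_pos[OF i(1)] by simp
    fix n assume n: "- (R ^^ n) x \<in> pos"
    show "Suc e \<le> n"
    proof (rule ccontr)
      assume "\<not> Suc e \<le> n"
      then have "n \<le> e" by simp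
      then have "(R ^^ n) x \<in> pos" using eq lt e by simp
      then show False using n pos_not_neg by blast
    qed
  qed
  then show thesis using that[of i e] i Ri eq lt e by simp
qed

end

section \<open>Compatibility in terms of the Euler form\<close>

definition neg_simple :: "('i \<Rightarrow> 'v::real_inner) \<Rightarrow> 'i set \<Rightarrow> 'v \<Rightarrow> bool" where
  "neg_simple a I x \<longleftrightarrow> (\<exists>i\<in>I. x = - a i)"

text \<open>
A condition on \<open>y\<close> only if \<open>x\<close> is a negative simple root; the root involved then must not occur in \<open>y\<close>.
\<close>

definition avoids :: "('i \<Rightarrow> 'v::real_inner) \<Rightarrow> 'i set \<Rightarrow> 'v \<Rightarrow> 'v \<Rightarrow> bool" where
  "avoids a I x y \<longleftrightarrow> (\<forall>i\<in>I. x = - a i \<longrightarrow> coord a I y i = 0)"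

text \<open>
In the crystallographic case \<open>euler a P N x y\<close> is, up to a positive factor, the dimension of \<open>Hom\<close>
minus that of \<open>Ext\<close> between the indecomposable representations with classes \<open>x\<close> and \<open>y\<close>. At most one of the two is
nonzero, so the inequalities say that both groups \<open>Ext\<close> vanish. The negative simple roots are treated
by cases because replacing them by vectors would depend on the whole index set, and the criterion
is meant to be insensitive to enlarging it.
\<close>

definition euler_compat :: "('i \<Rightarrow> 'v::real_inner) \<Rightarrow> 'i set \<Rightarrow> 'i set \<Rightarrow> 'v \<Rightarrow> 'v \<Rightarrow> bool" where
  "euler_compat a P N x y \<longleftrightarrow>
     x \<noteq> y \<and> avoids a (P \<union> N) x y \<and> avoids a (P \<union> N) y x \<and>
     (\<not> neg_simple a (P \<union> N) x \<longrightarrow> \<not> neg_simple a (P \<union> N) y \<longrightarrow>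
        0 \<le> euler a P N x y \<and> 0 \<le> euler a P N y x)"

text \<open>
The relation between a root \<open>x\<close> and a root \<open>y\<close> of lower color.
\<close>

definition euler_orthogonal :: "('i \<Rightarrow> 'v::real_inner) \<Rightarrow> 'i set \<Rightarrow> 'i set \<Rightarrow> 'v \<Rightarrow> 'v \<Rightarrow> bool" where
  "euler_orthogonal a P N x y \<longleftrightarrow>
     avoids a (P \<union> N) y x \<and> (\<not> neg_simple a (P \<union> N) y \<longrightarrow> euler a P N x y = 0)"

text \<open>
The criterion that replaces colored compatibility. It makes no reference to the root system, to the
rotation or to the depth.
\<close>

fun colored_compat :: "('i \<Rightarrow> 'v::real_inner) \<Rightarrow> 'i set \<Rightarrow> 'i set \<Rightarrow> 'v \<times> nat \<Rightarrow> 'v \<times> nat \<Rightarrow> bool" where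
  "colored_compat a P N (x, k) (y, l) \<longleftrightarrow>
     (if k = l then euler_compat a P N x y
      else if k > l then euler_orthogonal a P N x y
      else euler_orthogonal a P N y x)"

context bipartite_root_system
begin

abbreviation "ec \<equiv> euler_compat a P N"

lemma ec_sym: "ec x y \<longleftrightarrow> ec y x"
  unfolding euler_compat_def by blast

lemma not_neg_simple: "x \<in> pos \<Longrightarrow> \<not> neg_simple a I x"
  unfolding neg_simple_def using pos_not_neg_simple by blast

lemma avoids_pos: "x \<in> pos \<Longrightarrow> avoids a I x y"
  unfolding avoids_def using pos_not_neg_simple by blast

lemma avoids_neg_simple: "i \<in> I \<Longrightarrow> avoids a I (- a i) y \<longleftrightarrow> co y i = 0"
  unfolding avoids_def using inj_onD[OF inj_a, of i] by auto

lemma ec_pos: "x \<in> pos \<Longrightarrow> y \<in> pos \<Longrightarrow> ec x y \<longleftrightarrow> x \<noteq> y \<and> 0 \<le> E x y \<and> 0 \<le> E y x"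
  unfolding euler_compat_def using avoids_pos not_neg_simple by blast

lemma ec_neg_pos: 
  assumes "i \<in> I" "y \<in> pos"
  shows "ec (- a i) y \<longleftrightarrow> co y i = 0"
proof -
  have "neg_simple a I (- a i)" using assms(1) by (auto simp: neg_simple_def)
  then show ?thesis
    unfolding euler_compat_def
    using avoids_pos[OF assms(2)] avoids_neg_simple[OF assms(1)] pos_not_neg_simple[OF assms(2,1)] by blast
qed

lemma ec_neg_neg: 
  assumes "i \<in> I" "j \<in> I"
  shows "ec (- a i) (- a j) \<longleftrightarrow> i \<noteq> j"
proof -
  have "neg_simple a I (- a i)" using assms(1) by (auto simp: neg_simple_def)
  moreover have "- a i = - a j \<longleftrightarrow> i = j" using inj_onD[OF inj_a] assms by auto
  moreover have "i \<noteq> j \<Longrightarrow> co (- a j) i = 0 \<and> co (- a i) j = 0"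
    using assms by (simp add: coord_minus in_span_a coord_a)
  ultimately show ?thesis
    unfolding euler_compat_def using avoids_neg_simple assms by blast
qed

lemma ec_neg:
  assumes "i \<in> I" "y \<in> AP" "y \<noteq> - a i"
  shows "ec (- a i) y \<longleftrightarrow> co y i = 0"
  using assms ec_neg_pos ec_neg_neg by (auto simp: AP_iff coord_minus in_span_a coord_a)

text \<open>
The Euler form against \<open>Pr i\<close> or \<open>In i\<close> is a coefficient times \<open>\<alpha>\<^sub>i \<bullet> \<alpha>\<^sub>i / 2\<close>, so
its sign and its vanishing are those of the coefficient.
\<close>

lemma scaled_iff:
  assumes "i \<in> I"
  shows "0 \<le> t * (a i \<bullet> a i) / 2 \<longleftrightarrow> 0 \<le> t" "t * (a i \<bullet> a i) / 2 \<le> 0 \<longleftrightarrow> t \<le> 0"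
    "t * (a i \<bullet> a i) / 2 = 0 \<longleftrightarrow> t = 0"
proof -
  have "0 < q \<Longrightarrow> (0 \<le> t * q / 2 \<longleftrightarrow> 0 \<le> t) \<and> (t * q / 2 \<le> 0 \<longleftrightarrow> t \<le> 0) \<and> (t * q / 2 = 0 \<longleftrightarrow> t = 0)" for q :: real
    by (auto simp: zero_le_mult_iff mult_le_0_iff)
  moreover have "0 < a i \<bullet> a i" using a_nonzero[OF assms] by simp
  ultimately show "0 \<le> t * (a i \<bullet> a i) / 2 \<longleftrightarrow> 0 \<le> t" "t * (a i \<bullet> a i) / 2 \<le> 0 \<longleftrightarrow> t \<le> 0"
    "t * (a i \<bullet> a i) / 2 = 0 \<longleftrightarrow> t = 0" by blast+
qed

lemma euler_proj_nonneg: 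
  assumes "i \<in> I" "y \<in> pos" 
  shows "0 \<le> E (Pr i) y"
  unfolding euler_proj[OF assms(1) pos_in_V[OF assms(2)]] scaled_iff(1)[OF assms(1)]
  using assms pos_iff by blast

lemma euler_inj_nonneg: 
  assumes "i \<in> I" "y \<in> pos" 
  shows "0 \<le> E y (In i)"
  unfolding euler_inj[OF assms(1) pos_in_V[OF assms(2)]] scaled_iff(1)[OF assms(1)]
  using assms pos_iff by blast

lemma euler_proj_right: "i \<in> I \<Longrightarrow> y \<in> V \<Longrightarrow> E y (Pr i) = - E (c y) (In i)"
  using euler_c_invariant[of y "Pr i"] euler_minus_right[of "In i" "c y"]
  by (simp add: proj_in_V c_proj inj_in_V)

lemma euler_inj_left: "i \<in> I \<Longrightarrow> y \<in> V \<Longrightarrow> E (In i) (c y) = - E (Pr i) y"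
  using euler_c_invariant[of "Pr i" y] euler_minus_left[of "In i" "c y"]
  by (simp add: proj_in_V c_proj inj_in_V)

lemma c_proj_not_pos: "i \<in> I \<Longrightarrow> c (Pr i) \<notin> pos"
  using pos_not_neg[OF inj_pos] by (simp add: c_proj)

text \<open>
Of the two Euler values between \<open>Pr i\<close> and \<open>y\<close>, one is a coefficient of \<open>y\<close> and thus nonnegative, and
the other is minus a coefficient of \<open>c y\<close> and thus nonpositive. So compatibility means that the
latter coefficient vanishes.
\<close>

lemma ec_rot_proj:
  assumes i: "i \<in> I" and y: "y \<in> pos" "c y \<in> pos"
  shows "ec (Pr i) y \<longleftrightarrow> ec (- a i) (c y)"
proof -
  have "E y (Pr i) = - (co (c y) i * (a i \<bullet> a i) / 2)"
    using euler_proj_right[OF i pos_in_V[OF y(1)]] euler_inj[OF i pos_in_V[OF y(2)]] by simp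
  then have "0 \<le> E y (Pr i) \<longleftrightarrow> co (c y) i \<le> 0"
    using scaled_iff(2)[OF i] by (metis neg_0_le_iff_le)
  moreover have "0 \<le> co (c y) i" using y(2) i pos_iff by blast
  moreover have "y \<noteq> Pr i" using c_proj_not_pos[OF i] y(2) by blast
  ultimately show ?thesis
    using ec_pos[OF proj_pos[OF i] y(1)] euler_proj_nonneg[OF i y(1)] ec_neg_pos[OF i y(2)] by auto
qed

text \<open>
The mirror image of the preceding argument, at the moment when a negative simple root turns into \<open>In i\<close>.
\<close>

lemma ec_rot_neg:
  assumes i: "i \<in> I" and y: "y \<in> pos" "c y \<in> pos"
  shows "ec (- a i) y \<longleftrightarrow> ec (In i) (c y)"
proof -
  have "E (In i) (c y) = - (co y i * (a i \<bullet> a i) / 2)"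
    using euler_inj_left[OF i pos_in_V[OF y(1)]] euler_proj[OF i pos_in_V[OF y(1)]] by simp
  then have "0 \<le> E (In i) (c y) \<longleftrightarrow> co y i \<le> 0"
    using scaled_iff(2)[OF i] by (metis neg_0_le_iff_le)
  moreover have "0 \<le> co y i" using y(1) i pos_iff by blast
  moreover have "c y \<noteq> In i"
  proof
    assume "c y = In i"
    then have "c (- y) = c (Pr i)" using c_proj[OF i] by (simp add: linear_neg[OF c_linear])
    then have "- y = Pr i" 
      by (rule c_inj[OF span_neg[OF pos_in_V[OF y(1)]] proj_in_V[OF i]])
    then show False using pos_not_neg[OF y(1)] proj_pos[OF i] by simp
  qed
  ultimately show ?thesis
    using ec_pos[OF inj_pos[OF i] y(2)] euler_inj_nonneg[OF i y(2)] ec_neg_pos[OF i y(1)] by auto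
qed

lemma proj_eq_iff: 
  assumes "i \<in> I" "j \<in> I"
  shows "Pr i = Pr j \<longleftrightarrow> i = j"
proof
  assume eq: "Pr i = Pr j"
  show "i = j"
  proof (rule ccontr)
    assume "i \<noteq> j"
    then have "E (Pr j) (a i) = 0" "E (Pr i) (a i) > 0"
      using assms a_nonzero by (simp_all add: euler_proj in_span_a coord_a)
    then show False using eq by simp
  qed
qed simp

lemma inj_eq_iff: "i \<in> I \<Longrightarrow> j \<in> I \<Longrightarrow> In i = In j \<longleftrightarrow> i = j"
  using c_inj[OF proj_in_V proj_in_V] proj_eq_iff c_proj by metis

lemma ec_proj_proj: "i \<in> I \<Longrightarrow> j \<in> I \<Longrightarrow> ec (Pr i) (Pr j) \<longleftrightarrow> i \<noteq> j"
  by (simp add: ec_pos proj_pos euler_proj_nonneg proj_eq_iff)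

lemma ec_inj_inj: "i \<in> I \<Longrightarrow> j \<in> I \<Longrightarrow> ec (In i) (In j) \<longleftrightarrow> i \<noteq> j"
  by (simp add: ec_pos inj_pos euler_inj_nonneg inj_eq_iff)

lemma ec_rot_proj_neg:
  assumes "i \<in> I" "j \<in> I"
  shows "ec (Pr i) (- a j) \<longleftrightarrow> ec (- a i) (In j)"
proof -
  have "co (Pr i) j * (a j \<bullet> a j) = co (In j) i * (a i \<bullet> a i)"
    using euler_inj[OF assms(2) proj_in_V[OF assms(1)]] euler_proj[OF assms(1) inj_in_V[OF assms(2)]] by simp
  then have "co (Pr i) j = 0 \<longleftrightarrow> co (In j) i = 0"
    using a_nonzero assms by (metis inner_eq_zero_iff mult_eq_0_iff)
  then show ?thesis
    using ec_neg_pos[OF assms(2) proj_pos[OF assms(1)]] ec_neg_pos[OF assms(1) inj_pos[OF assms(2)]] ec_sym by blast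
qed

lemma ec_rot_pos_pos:
  assumes "x \<in> pos" "y \<in> pos" "c x \<in> pos" "c y \<in> pos"
  shows "ec x y \<longleftrightarrow> ec (c x) (c y)"
  using assms c_inj[OF pos_in_V pos_in_V] by (auto simp: ec_pos euler_c_invariant pos_in_V)

lemma ec_rot_of_pos:
  assumes "x \<in> pos" "y \<in> AP"
  shows "ec (R x) (R y) \<longleftrightarrow> ec x y"
proof -
  consider "y \<in> pos" | j where "j \<in> I" "y = - a j" using assms(2) by (auto simp: AP_iff)
  then show ?thesis
  proof cases
    case 1
    from assms(1) show ?thesis
    proof (cases rule: rot_pos_cases)
      case x: (proj i)
      from 1 show ?thesis
        by (cases rule: rot_pos_cases)
           (use x 1 in \<open>simp_all add: ec_proj_proj ec_neg_neg ec_rot_proj\<close>)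
    next
      case x: pos
      from 1 show ?thesis
      proof (cases rule: rot_pos_cases)
        case (proj i)
        then show ?thesis using x assms(1) ec_rot_proj ec_sym by metis
      next
        case pos
        then show ?thesis using x assms(1) 1 by (simp add: ec_rot_pos_pos)
      qed
    qed
  next
    case 2
    from assms(1) show ?thesis
    proof (cases rule: rot_pos_cases)
      case (proj i)
      then show ?thesis using 2 by (simp add: rot_neg_simple ec_rot_proj_neg)
    next
      case pos
      then show ?thesis using 2 assms(1) ec_rot_neg rot_neg_simple ec_sym by metis
    qed
  qed
qed

text \<open>
Each root of the pair is of one of three kinds under the rotation: moved by \<open>c\<close> within the positive
roots, moved from \<open>Pr i\<close> to \<open>- \<alpha>\<^sub>i\<close>, or moved from \<open>- \<alpha>\<^sub>i\<close> to \<open>In i\<close>. The lemmas above treat all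
combinations of kinds.
\<close>

lemma ec_rot:
  assumes "x \<in> AP" "y \<in> AP"
  shows "ec (R x) (R y) \<longleftrightarrow> ec x y"
proof -
  consider "x \<in> pos" | "y \<in> pos" | i j where "i \<in> I" "x = - a i" "j \<in> I" "y = - a j" 
    using assms by (auto simp: AP_iff)
  then show ?thesis
  proof cases
    case 1 then show ?thesis using ec_rot_of_pos assms by blast
  next
    case 2 then show ?thesis using ec_rot_of_pos assms ec_sym by blast
  next
    case 3 then show ?thesis by (simp add: rot_neg_simple ec_inj_inj ec_neg_neg)
  qed
qed

text \<open>
The relation exists because the Euler criterion survives the rotation; the values at negative simple
roots are built into it.
\<close>

lemma is_compat_relation_euler:
  "is_compat_relation \<Phi> a P N {(x, y). x \<in> AP \<and> y \<in> AP \<and> ec x y}"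
  unfolding is_compat_relation_def Let_def
proof (intro conjI ballI impI)
  show "irrefl {(x, y). x \<in> AP \<and> y \<in> AP \<and> ec x y}"
    by (auto simp: irrefl_def euler_compat_def)
  show "sym {(x, y). x \<in> AP \<and> y \<in> AP \<and> ec x y}"
    using ec_sym by (auto simp: sym_def)
  show "(- a i, y) \<in> {(x, y). x \<in> AP \<and> y \<in> AP \<and> ec x y} \<longleftrightarrow> \<not> involves a I y i"
    if "i \<in> I" "y \<in> AP" "y \<noteq> - a i" for i y
    using that ec_neg[OF that] by (auto simp: involves_iff AP_iff)
  show "(x, y) \<in> {(x, y). x \<in> AP \<and> y \<in> AP \<and> ec x y} \<longleftrightarrow>
      (R x, R y) \<in> {(x, y). x \<in> AP \<and> y \<in> AP \<and> ec x y}"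
    if "x \<in> AP" "y \<in> AP" for x y
    using that ec_rot rot_AP by simp
qed auto

lemma AP_reaches_neg_simple:
  assumes "x \<in> AP"
  shows "\<exists>n. \<exists>i\<in>I. (R ^^ n) x = - a i"
proof (cases "x \<in> pos")
  case True then show ?thesis by (meson pos_orbit)
next
  case False
  then show ?thesis using assms by (intro exI[of _ 0]) (auto simp: AP_iff)
qed

text \<open>
Rotating a pair until its first member is a negative simple root reduces every question of
compatibility to the prescribed values.
\<close>

lemma compat_relation_unique:
  assumes C: "is_compat_relation \<Phi> a P N C" and D: "is_compat_relation \<Phi> a P N D"
    and xy: "x \<in> AP" "y \<in> AP"
  shows "(x, y) \<in> C \<longleftrightarrow> (x, y) \<in> D"
proof -
  obtain n i where "i \<in> I" "(R ^^ n) x = - a i" using AP_reaches_neg_simple[OF xy(1)] by blast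
  then show ?thesis
    using xy
  proof (induction n arbitrary: x y)
    case 0
    then have x: "x = - a i" by simp
    show ?case
    proof (cases "y = - a i")
      case True
      then show ?thesis using x C D by (simp add: is_compat_relation_def Let_def irrefl_def)
    next
      case False
      have "(- a i, y) \<in> K \<longleftrightarrow> \<not> involves a I y i" if "is_compat_relation \<Phi> a P N K" for K
        using that 0(1,4) False unfolding is_compat_relation_def Let_def by blast
      then show ?thesis using x C D by simp
    qed
  next
    case (Suc n)
    have "(x, y) \<in> C \<longleftrightarrow> (R x, R y) \<in> C" "(x, y) \<in> D \<longleftrightarrow> (R x, R y) \<in> D"
      using C D Suc.prems(3,4) unfolding is_compat_relation_def Let_def by blast+
    moreover have "(R x, R y) \<in> C \<longleftrightarrow> (R x, R y) \<in> D"
      using Suc.prems rot_AP by (intro Suc.IH) (auto simp: funpow_swap1)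
    ultimately show ?case by simp
  qed
qed

lemma compat_relation_eq: "compat_relation \<Phi> a P N = {(x, y). x \<in> AP \<and> y \<in> AP \<and> ec x y}"
  unfolding compat_relation_def
proof (rule the_equality[where P = "is_compat_relation \<Phi> a P N", OF is_compat_relation_euler])
  fix C assume C: "is_compat_relation \<Phi> a P N C"
  then have "C \<subseteq> AP \<times> AP" by (simp add: is_compat_relation_def Let_def)
  then show "C = {(x, y). x \<in> AP \<and> y \<in> AP \<and> ec x y}"
    using compat_relation_unique[OF C is_compat_relation_euler] by auto
qed

lemma ec_rot_pow:
  assumes "x \<in> AP" "y \<in> AP"
  shows "ec ((R ^^ n) x) ((R ^^ n) y) \<longleftrightarrow> ec x y"
proof (induction n)
  case (Suc n)
  have "(R ^^ n) z \<in> AP" if "z \<in> AP" for z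
    using that by (induction n) (auto simp: rot_AP)
  then show ?case using Suc ec_rot assms by simp
qed simp

lemma pos_AP: "x \<in> pos \<Longrightarrow> x \<in> AP"
  by (simp add: AP_iff)

text \<open>
Rotate until \<open>y\<close> becomes \<open>- \<alpha>\<^sub>j\<close>. The root \<open>x\<close> has by then been moved by \<open>c\<close> only, so \<open>E x y\<close> is
unchanged up to replacing \<open>y\<close> by its \<open>c\<close>-image \<open>- In j\<close>, and it measures the coefficient of
\<open>\<alpha>\<^sub>j\<close>.
\<close>

lemma ec_deeper:
  assumes "x \<in> pos" "y \<in> pos" "dp y < dp x"
  shows "ec x y \<longleftrightarrow> E x y = 0"
proof -
  obtain e where x: "dp x = Suc e" "\<And>n. n \<le> e \<Longrightarrow> (R ^^ n) x = (c ^^ n) x \<and> (c ^^ n) x \<in> pos"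
    using pos_orbit[OF assms(1)] by metis
  obtain f j where y: "j \<in> I" "dp y = Suc f" "(c ^^ f) y = Pr j" "(R ^^ Suc f) y = - a j"
    using pos_orbit[OF assms(2)] by metis
  have fe: "Suc f \<le> e" using x(1) y(2) assms(3) by simp
  define z where "z = (c ^^ Suc f) x"
  have z: "z \<in> pos" "(R ^^ Suc f) x = z" using x(2)[OF fe] by (simp_all add: z_def)
  have "E x y = E ((c ^^ Suc f) x) ((c ^^ Suc f) y)"
    by (rule euler_c_pow[symmetric]) (use assms pos_in_V in auto)
  also have "\<dots> = E z (- In j)" using c_proj[OF y(1)] y(3) by (simp add: z_def)
  also have "\<dots> = - (co z j * (a j \<bullet> a j) / 2)"
    using euler_minus_right[OF inj_in_V[OF y(1)]] euler_inj[OF y(1) pos_in_V[OF z(1)]] by simp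
  finally have "E x y = 0 \<longleftrightarrow> co z j = 0" using scaled_iff(3)[OF y(1)] by (metis neg_equal_0_iff_equal)
  moreover have "ec x y \<longleftrightarrow> ec z (- a j)"
    using ec_rot_pow[OF pos_AP[OF assms(1)] pos_AP[OF assms(2)], of "Suc f"] z(2) y(4) by simp
  ultimately show ?thesis using ec_neg_pos[OF y(1) z(1)] ec_sym by blast
qed

text \<open>
Here \<open>x\<close> reaches \<open>Pr i\<close> while \<open>y\<close> is still positive. As \<open>R x\<close> is one step ahead, it is then \<open>- \<alpha>\<^sub>i\<close>,
and \<open>E x y\<close> measures the coefficient of \<open>\<alpha>\<^sub>i\<close> in the rotated \<open>y\<close>.
\<close>

lemma ec_rot_shallower:
  assumes "x \<in> pos" "y \<in> pos" "dp x \<le> dp y"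
  shows "ec (R x) y \<longleftrightarrow> E x y = 0"
proof -
  obtain e i where x: "i \<in> I" "dp x = Suc e" "(c ^^ e) x = Pr i" "(R ^^ Suc e) x = - a i"
    using pos_orbit[OF assms(1)] by metis
  obtain f where y: "dp y = Suc f" "\<And>n. n \<le> f \<Longrightarrow> (R ^^ n) y = (c ^^ n) y \<and> (c ^^ n) y \<in> pos"
    using pos_orbit[OF assms(2)] by metis
  define z where "z = (c ^^ e) y"
  have z: "z \<in> pos" "(R ^^ e) y = z" using y(2)[of e] x(2) y(1) assms(3) by (simp_all add: z_def)
  have "E x y = E ((c ^^ e) x) ((c ^^ e) y)"
    by (rule euler_c_pow[symmetric]) (use assms pos_in_V in auto)
  also have "\<dots> = co z i * (a i \<bullet> a i) / 2"
    using euler_proj[OF x(1) pos_in_V[OF z(1)]] x(3) by (simp add: z_def)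
  finally have "E x y = 0 \<longleftrightarrow> co z i = 0" using scaled_iff(3)[OF x(1)] by metis
  moreover have "ec (R x) y \<longleftrightarrow> ec (- a i) z"
    using ec_rot_pow[OF rot_AP[OF pos_AP[OF assms(1)]] pos_AP[OF assms(2)], of e] z(2) x(4)
    by (simp add: funpow_swap1)
  ultimately show ?thesis using ec_neg_pos[OF x(1) z(1)] by blast
qed

text \<open>
The two alternatives for a pair with the higher color on \<open>x\<close> give the same condition, in which the
depths no longer occur.
\<close>

lemma higher_color_iff:
  assumes "x \<in> pos" "y \<in> AP"
  shows "(dp x \<le> dp y \<and> ec (R x) y) \<or> (dp y < dp x \<and> ec x y) \<longleftrightarrow> euler_orthogonal a P N x y"
proof (cases "y \<in> pos")
  case True
  then have "euler_orthogonal a P N x y \<longleftrightarrow> E x y = 0"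
    by (simp add: euler_orthogonal_def avoids_pos not_neg_simple)
  then show ?thesis 
    using ec_deeper[OF assms(1) True] ec_rot_shallower[OF assms(1) True] by (meson not_le)
next
  case False
  then obtain i where i: "i \<in> I" "y = - a i" using assms(2) by (auto simp: AP_iff)
  have "dp y < dp x" using depth_neg_simple i pos_orbit[OF assms(1)] by (metis zero_less_Suc)
  moreover have "neg_simple a I y" using i by (auto simp: neg_simple_def)
  then have "euler_orthogonal a P N x y \<longleftrightarrow> co x i = 0"
    using i by (simp add: euler_orthogonal_def avoids_neg_simple)
  ultimately show ?thesis using ec_neg_pos[OF i(1) assms(1)] i(2) ec_sym by auto
qed

lemma colored_rootD:
  assumes "(x, k) \<in> colored_roots \<Phi> a I m"
  shows "x \<in> AP" "1 \<le> k" "x \<in> pos \<or> k = 1"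
  using assms by (auto simp: colored_roots_def AP_iff)

lemma compat_irreducible_iff:
  assumes x: "(x, k) \<in> colored_roots \<Phi> a I m" and y: "(y, l) \<in> colored_roots \<Phi> a I m"
  shows "compat_irreducible \<Phi> a P N m (x, k) (y, l) \<longleftrightarrow> colored_compat a P N (x, k) (y, l)"
proof -
  have AP: "x \<in> AP" "y \<in> AP" using x y colored_rootD by blast+
  have C: "(u, v) \<in> compat_relation \<Phi> a P N \<longleftrightarrow> u \<in> AP \<and> v \<in> AP \<and> ec u v" for u v
    by (simp add: compat_relation_eq)
  consider "k = l" | "l < k" | "k < l" by linarith
  then show ?thesis
  proof cases
    case 1
    then show ?thesis using x y AP by (simp add: C Let_def)
  next
    case 2
    then have "x \<in> pos" using colored_rootD[OF x] colored_rootD[OF y] by auto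
    from higher_color_iff[OF this AP(2)] show ?thesis
      using 2 x y AP rot_AP by (auto simp: C Let_def)
  next
    case 3
    then have "y \<in> pos" using colored_rootD[OF x] colored_rootD[OF y] by auto
    from higher_color_iff[OF this AP(1)] show ?thesis
      using 3 x y AP rot_AP ec_sym[of x] by (auto simp: C Let_def)
  qed
qed

end

section \<open>Restriction to a set of simple roots\<close>

context bipartite_basis
begin

lemma coord_outside:
  assumes "K \<subseteq> I" "x \<in> span (a ` K)" "i \<in> I" "i \<notin> K"
  shows "co x i = 0"
proof -
  have "span (a ` K) \<subseteq> V" using assms(1) by (intro span_mono image_mono)
  then show ?thesis using in_span_subset_iff[OF assms(1), of x] assms by blast
qed

lemma part_restrict:
  assumes "K \<subseteq> I" "L \<subseteq> I" "x \<in> span (a ` K)"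
  shows "simple_part a K (K \<inter> L) x = simple_part a I L x"
proof -
  have "simple_part a K (K \<inter> L) x = (\<Sum>i\<in>K \<inter> L. co x i *\<^sub>R a i)"
    unfolding simple_part_def using coord_subset[OF assms(1,3)] by simp
  also have "\<dots> = (\<Sum>i\<in>L. co x i *\<^sub>R a i)"
    using coord_outside[OF assms(1,3)] finite_subset[OF assms(2) finite_I] assms(2)
    by (intro sum.mono_neutral_left) auto
  finally show ?thesis by (simp add: simple_part_def)
qed

lemma euler_restrict:
  assumes "K \<subseteq> I" "x \<in> span (a ` K)" "y \<in> span (a ` K)"
  shows "euler a (K \<inter> P) (K \<inter> N) x y = E x y"
proof -
  have K: "(K \<inter> P) \<union> (K \<inter> N) = K" using assms(1) by blast
  have "P \<subseteq> I" "N \<subseteq> I" by auto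
  then show ?thesis
    unfolding euler_def K Let_def using assms by (simp only: part_restrict)
qed

lemma neg_simple_index:
  assumes "K \<subseteq> I" "i \<in> I" "- a i \<in> span (a ` K)"
  shows "i \<in> K"
proof (rule ccontr)
  assume "i \<notin> K"
  then have "co (- a i) i = 0" using coord_outside[OF assms(1,3,2)] by blast
  then show False using assms(2) by (simp add: coord_minus in_span_a coord_a)
qed

lemma neg_simple_restrict:
  assumes "K \<subseteq> I" "x \<in> span (a ` K)"
  shows "neg_simple a K x \<longleftrightarrow> neg_simple a I x"
  unfolding neg_simple_def using neg_simple_index[OF assms(1)] assms by blast

lemma avoids_restrict:
  assumes "K \<subseteq> I" "x \<in> span (a ` K)" "y \<in> span (a ` K)"
  shows "avoids a K x y \<longleftrightarrow> avoids a I x y"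
  unfolding avoids_def coord_subset[OF assms(1,3)]
  using neg_simple_index[OF assms(1)] assms(1,2) by blast

text \<open>
Every ingredient of the criterion is computed from coordinates, which do not change when the basis
is reduced to a part whose span contains both roots.
\<close>

lemma colored_compat_restrict:
  assumes "K \<subseteq> I" "x \<in> span (a ` K)" "y \<in> span (a ` K)"
  shows "colored_compat a (K \<inter> P) (K \<inter> N) (x, k) (y, l) \<longleftrightarrow> colored_compat a P N (x, k) (y, l)"
proof -
  have "(K \<inter> P) \<union> (K \<inter> N) = K" using assms(1) by blast
  then show ?thesis
    using assms 
    by (simp add: euler_compat_def euler_orthogonal_def euler_restrict avoids_restrict neg_simple_restrict)
qed

end


section \<open>Parabolic subsystems and irreducible components\<close>

lemma refl_along_self: "x \<noteq> 0 \<Longrightarrow> refl_along x x = - x"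
  by (simp add: refl_along_def scaleR_2)

lemma refl_along_involutive:
  assumes "x \<noteq> 0"
  shows "refl_along x (refl_along x y) = y"
proof -
  have "refl_along x y \<bullet> x = - (y \<bullet> x)"
    using assms by (simp add: refl_along_def inner_diff_left)
  then have "refl_along x (refl_along x y) = refl_along x y + (2 * (y \<bullet> x) / (x \<bullet> x)) *\<^sub>R x"
    by (simp add: refl_along_def[of x "refl_along x y"])
  then show ?thesis by (simp add: refl_along_def)
qed

lemma root_system_subset:
  assumes "root_system \<Phi>" "\<Psi> \<subseteq> \<Phi>" "\<And>x y. x \<in> \<Psi> \<Longrightarrow> y \<in> \<Psi> \<Longrightarrow> refl_along x y \<in> \<Psi>"
  shows "root_system \<Psi>"
  unfolding root_system_def
proof (intro conjI ballI)
  show "finite \<Psi>" "0 \<notin> \<Psi>" using assms(1,2) finite_subset by (auto simp: root_system_def)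
  fix x assume x: "x \<in> \<Psi>"
  then have nz: "x \<noteq> 0" using \<open>0 \<notin> \<Psi>\<close> by blast
  have "- x \<in> \<Psi>" using assms(3)[OF x x] refl_along_self[OF nz] by simp
  moreover have "\<Phi> \<inter> span {x} = {x, - x}" using assms(1,2) x by (auto simp: root_system_def)
  ultimately show "\<Psi> \<inter> span {x} = {x, - x}" using x assms(2) by blast
  show "refl_along x ` \<Psi> = \<Psi>"
  proof
    show "refl_along x ` \<Psi> \<subseteq> \<Psi>" using assms(3) x by blast
    show "\<Psi> \<subseteq> refl_along x ` \<Psi>"
      using assms(3)[OF x] refl_along_involutive[OF nz] by (metis image_eqI subsetI)
  qed
qed

text \<open>
A subset which contains \<open>x\<close>, is orthogonal to its complement and has minimal cardinality cannot split.
\<close>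

lemma component_exists:
  assumes "finite \<Phi>" "x \<in> \<Phi>"
  obtains \<Psi> where "\<Psi> \<in> irreducible_components \<Phi>" "x \<in> \<Psi>"
proof -
  define closed where "closed S \<longleftrightarrow> S \<subseteq> \<Phi> \<and> x \<in> S \<and> (\<forall>u\<in>S. \<forall>v\<in>\<Phi> - S. u \<bullet> v = 0)" for S
  have "closed \<Phi>" using assms(2) by (simp add: closed_def)
  then obtain \<Psi> where \<Psi>: "closed \<Psi>" and min: "\<And>S. closed S \<Longrightarrow> card \<Psi> \<le> card S"
    using ex_has_least_nat[of closed \<Phi> card] by blast
  have fin: "finite \<Psi>" using \<Psi> assms(1) finite_subset unfolding closed_def by blast
  have no_split: False
    if AB: "x \<in> A" "B \<noteq> {}" "A \<inter> B = {}" "A \<union> B = \<Psi>" "\<forall>u\<in>A. \<forall>v\<in>B. u \<bullet> v = 0" for A B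
  proof -
    have "closed A" using AB \<Psi> unfolding closed_def by blast
    moreover have "card A < card \<Psi>" using AB fin by (intro psubset_card_mono) auto
    ultimately show False using min[of A] by simp
  qed
  have "irreducible_root_system \<Psi>"
    unfolding irreducible_root_system_def
  proof (intro conjI notI)
    assume "\<Psi> = {}" then show False using \<Psi> by (simp add: closed_def)
  next
    assume "\<exists>A B. A \<noteq> {} \<and> B \<noteq> {} \<and> A \<inter> B = {} \<and> A \<union> B = \<Psi> \<and> (\<forall>x\<in>A. \<forall>y\<in>B. x \<bullet> y = 0)"
    then obtain A B where AB: "A \<noteq> {}" "B \<noteq> {}" "A \<inter> B = {}" "A \<union> B = \<Psi>"
      "\<forall>x\<in>A. \<forall>y\<in>B. x \<bullet> y = 0" by blast
    \<comment> \<open>the component of \<open>x\<close> in a splitting may be either of the two sets\<close>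
    have BA: "\<forall>u\<in>B. \<forall>v\<in>A. u \<bullet> v = 0" using AB(5) by (metis inner_commute)
    have "x \<in> A \<union> B" using \<Psi> AB(4) by (simp add: closed_def)
    then show False
      using no_split[OF _ AB(2-5)] no_split[OF _ AB(1) _ _ BA] AB(3,4) by blast
  qed
  then show thesis
    using \<Psi> by (intro that[of \<Psi>]) (auto simp: irreducible_components_def closed_def)
qed

lemma component_subset:
  assumes "\<Psi> \<in> irreducible_components \<Phi>" "\<Psi>' \<in> irreducible_components \<Phi>" "x \<in> \<Psi>" "x \<in> \<Psi>'"
  shows "\<Psi> \<subseteq> \<Psi>'"
proof (rule ccontr)
  assume "\<not> \<Psi> \<subseteq> \<Psi>'"
  then have ne: "\<Psi> - \<Psi>' \<noteq> {}" by blast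
  have "\<forall>u\<in>\<Psi> \<inter> \<Psi>'. \<forall>v\<in>\<Psi> - \<Psi>'. u \<bullet> v = 0"
    using assms(1,2) unfolding irreducible_components_def by blast
  then have "\<exists>A B. A \<noteq> {} \<and> B \<noteq> {} \<and> A \<inter> B = {} \<and> A \<union> B = \<Psi> \<and> (\<forall>x\<in>A. \<forall>y\<in>B. x \<bullet> y = 0)"
    using ne assms(3,4) by (intro exI[of _ "\<Psi> \<inter> \<Psi>'"] exI[of _ "\<Psi> - \<Psi>'"] conjI) auto
  moreover have "irreducible_root_system \<Psi>" using assms(1) by (simp add: irreducible_components_def)
  ultimately show False by (simp add: irreducible_root_system_def)
qed

lemma component_unique:
  assumes "\<Psi> \<in> irreducible_components \<Phi>" "\<Psi>' \<in> irreducible_components \<Phi>" "x \<in> \<Psi>" "x \<in> \<Psi>'"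
  shows "\<Psi> = \<Psi>'"
  using component_subset assms by (metis subset_antisym)

context bipartite_root_system
begin

lemma subsystem:
  assumes "\<Psi> \<subseteq> \<Phi>" "\<And>x y. x \<in> \<Psi> \<Longrightarrow> y \<in> \<Psi> \<Longrightarrow> refl_along x y \<in> \<Psi>"
    and K: "K \<subseteq> I" "a ` K \<subseteq> \<Psi>" "\<Psi> \<subseteq> span (a ` K)"
  shows "bipartite_root_system \<Psi> a (K \<inter> P) (K \<inter> N)"
proof
  have PN: "K \<inter> P \<union> K \<inter> N = K" using K(1) by blast
  interpret K: indexed_basis a K by (rule subbasis[OF K(1)])
  show "root_system \<Psi>" by (rule root_system_subset[OF roots assms(1,2)])
  have "nonneg_comb a K x \<or> nonneg_comb a K (- x)" if x: "x \<in> \<Psi>" for x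
  proof -
    have xK: "x \<in> span (a ` K)" "- x \<in> span (a ` K)" using x K(3) span_neg by blast+
    have "nonneg_comb a K y" if "y \<in> pos" "y \<in> span (a ` K)" for y
      unfolding K.nonneg_comb_iff[OF that(2)] coord_subset[OF K(1) that(2)]
      using that(1) K(1) pos_iff by blast
    then show ?thesis using root_cases xK x assms(1) by blast
  qed
  then show "simple_roots \<Psi> a (K \<inter> P \<union> K \<inter> N)"
    unfolding PN simple_roots_def using K.inj_a K.indep_a K(2) by blast
qed (use disjoint td_P td_N in \<open>auto simp: totally_disconnected_def\<close>)

lemma colored_roots_subsystem:
  assumes "K \<subseteq> I" "x \<in> \<Psi>" "\<Psi> \<subseteq> span (a ` K)" "(x, k) \<in> colored_roots \<Phi> a I m"
  shows "(x, k) \<in> colored_roots \<Psi> a K m"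
proof -
  interpret K: indexed_basis a K by (rule subbasis[OF assms(1)])
  have xK: "x \<in> span (a ` K)" using assms(2,3) by blast
  have "x \<in> pos_roots \<Psi> a K" if "x \<in> pos"
    unfolding pos_roots_def
    using assms(1,2) that pos_iff K.nonneg_comb_iff[OF xK] coord_subset[OF assms(1) xK] by auto
  moreover have "i \<in> K" if "i \<in> I" "x = - a i" for i
    using neg_simple_index[OF assms(1)] that xK by blast
  ultimately show ?thesis using assms(4) unfolding colored_roots_def by blast
qed

text \<open>
Split a root \<open>x\<close> of the component into the parts \<open>v\<close> and \<open>u\<close> along the simple roots inside and
outside the component. Then \<open>u\<close> is orthogonal to the component, hence to \<open>x\<close> and to \<open>v\<close>, and so to
itself.
\<close>

lemma component_in_span:
  assumes "\<Psi> \<in> irreducible_components \<Phi>"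
  shows "\<Psi> \<subseteq> span (a ` idx_in \<Psi> a I)"
proof
  fix x assume x: "x \<in> \<Psi>"
  define K where "K = idx_in \<Psi> a I"
  have K: "K \<subseteq> I" by (auto simp: K_def idx_in_def)
  have orth: "u \<bullet> v = 0" if "u \<in> \<Psi>" "v \<in> \<Phi> - \<Psi>" for u v
    using assms that by (auto simp: irreducible_components_def)
  have outside: "a i \<in> \<Phi> - \<Psi>" if "i \<in> I - K" for i
    using that simple_pos pos_root by (auto simp: K_def idx_in_def)
  define u where "u = simple_part a I (I - K) x"
  define v where "v = simple_part a I K x"
  have "x \<in> \<Phi>" using assms x by (auto simp: irreducible_components_def)
  then have "v + u = x"
    unfolding u_def v_def using K by (intro part_split root_in_V) auto
  have orth_u: "w \<bullet> u = 0" if "w \<in> \<Psi>" for w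
    unfolding u_def simple_part_def inner_sum_right
    using orth[OF that outside] by (intro sum.neutral) simp
  have "v \<bullet> u = 0"
    unfolding v_def simple_part_def inner_sum_left
    using orth_u by (intro sum.neutral) (simp add: K_def idx_in_def)
  then have "u \<bullet> u = x \<bullet> u" using \<open>v + u = x\<close> by (metis add_0 inner_add_left)
  then have "u = 0" using orth_u[OF x] by simp
  then have "x = v" using \<open>v + u = x\<close> by simp
  also have "v \<in> span (a ` K)"
    unfolding v_def simple_part_def by (intro span_sum span_scale span_base imageI)
  finally show "x \<in> span (a ` idx_in \<Psi> a I)" by (simp add: K_def)
qed

text \<open>
Were the reflected root outside the component, it would be orthogonal to \<open>x\<close>. Then \<open>y\<close> would be
orthogonal to \<open>x\<close> as well and be fixed by the reflection.
\<close>

lemma component_refl_closed: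
  assumes "\<Psi> \<in> irreducible_components \<Phi>" "x \<in> \<Psi>" "y \<in> \<Psi>"
  shows "refl_along x y \<in> \<Psi>"
proof (rule ccontr)
  assume *: "refl_along x y \<notin> \<Psi>"
  have sub: "\<Psi> \<subseteq> \<Phi>" using assms(1) by (simp add: irreducible_components_def)
  then have "refl_along x y \<in> \<Phi>" using roots assms(2,3) unfolding root_system_def by blast
  then have "x \<bullet> refl_along x y = 0" using * assms(1,2) by (simp add: irreducible_components_def)
  moreover have "x \<noteq> 0" using sub assms(2) root_nonzero by blast
  ultimately have "y \<bullet> x = 0" by (simp add: refl_along_def inner_diff_right inner_commute)
  then have "refl_along x y = y" by (simp add: refl_along_def)
  then show False using * assms(3) by simp
qed

lemma component_subsystem:
  assumes "\<Psi> \<in> irreducible_components \<Phi>"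
  shows "bipartite_root_system \<Psi> a (idx_in \<Psi> a P) (idx_in \<Psi> a N)"
proof -
  have "idx_in \<Psi> a P = idx_in \<Psi> a I \<inter> P" "idx_in \<Psi> a N = idx_in \<Psi> a I \<inter> N"
    by (auto simp: idx_in_def)
  moreover have "bipartite_root_system \<Psi> a (idx_in \<Psi> a I \<inter> P) (idx_in \<Psi> a I \<inter> N)"
  proof (rule subsystem)
    show "\<Psi> \<subseteq> \<Phi>" using assms by (simp add: irreducible_components_def)
  qed (use component_refl_closed[OF assms] component_in_span[OF assms] in \<open>auto simp: idx_in_def\<close>)
  ultimately show ?thesis by simp
qed

lemma parabolic_subsystem:
  assumes "J \<subseteq> I"
  shows "bipartite_root_system (parabolic \<Phi> a J) a (J \<inter> P) (J \<inter> N)"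
proof (rule subsystem)
  fix x y assume xy: "x \<in> parabolic \<Phi> a J" "y \<in> parabolic \<Phi> a J"
  then have "refl_along x y \<in> \<Phi>" using roots unfolding root_system_def parabolic_def by blast
  moreover have "refl_along x y \<in> span (a ` J)"
    using xy unfolding refl_along_def parabolic_def by (auto intro!: span_diff span_scale)
  ultimately show "refl_along x y \<in> parabolic \<Phi> a J" by (simp add: parabolic_def)
next
  show "a ` J \<subseteq> parabolic \<Phi> a J"
    using assms simple_pos pos_root by (auto simp: parabolic_def span_base)
qed (use assms in \<open>auto simp: parabolic_def\<close>)

lemma colored_root_in: "(x, k) \<in> colored_roots \<Phi> a I m \<Longrightarrow> x \<in> \<Phi>"
  using colored_rootD(1) pos_root neg_root simple_pos unfolding AP_iff by metis

text \<open>
Simple roots of different components are orthogonal, so the Euler form vanishes in both orders, and a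
negative simple root is not involved in roots of another component.
\<close>

lemma colored_compat_distinct_components:
  assumes \<Psi>: "\<Psi> \<in> irreducible_components \<Phi>" "\<Psi>' \<in> irreducible_components \<Phi>" "\<Psi> \<noteq> \<Psi>'"
    and x: "x \<in> \<Psi>" and y: "y \<in> \<Psi>'"
  shows "colored_compat a P N (x, k) (y, l)"
proof -
  have co_zero: "co z i = 0" if "i \<in> I" "a i \<notin> X" "z \<in> X" "X \<in> irreducible_components \<Phi>" for X z i
    using coord_outside[of "idx_in X a I" z i] component_in_span[OF that(4)] that
    by (auto simp: idx_in_def)
  have disj: "\<Psi> \<inter> \<Psi>' = {}" using component_unique \<Psi> by blast
  have orth: "u \<bullet> v = 0" if "u \<in> \<Psi>" "v \<in> \<Psi>'" for u v
    using that \<Psi>(1,2) disj unfolding irreducible_components_def by blast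
  have parts: "simple_part a I K x \<bullet> simple_part a I L y = 0" if "K \<subseteq> I" "L \<subseteq> I" for K L
    unfolding simple_part_def inner_sum_left inner_sum_right
  proof (intro sum.neutral ballI)
    fix i j assume "i \<in> K" "j \<in> L"
    then have "a i \<in> \<Psi> \<and> a j \<in> \<Psi>' \<or> co x i = 0 \<or> co y j = 0"
      using co_zero x y \<Psi> that by blast
    then show "(co x i *\<^sub>R a i) \<bullet> (co y j *\<^sub>R a j) = 0" using orth by auto
  qed
  have "E x y = 0" "E y x = 0"
    unfolding euler_def Let_def using parts by (simp_all add: inner_commute[of "simple_part a I _ y"])
  moreover have neg: "a i \<in> X" if "- a i \<in> X" "i \<in> I" "X \<in> irreducible_components \<Phi>" for i X
    using component_refl_closed[OF that(3,1,1)] refl_along_self[of "- a i"] a_nonzero[OF that(2)] by simp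
  have "avoids a I x y" "avoids a I y x"
    unfolding avoids_def using co_zero neg x y \<Psi> disj by blast+
  moreover have "x \<noteq> y" using x y disj by blast
  ultimately show ?thesis by (simp add: euler_compat_def euler_orthogonal_def)
qed

text \<open>
Inside a component the criterion is that of the component, by restriction; across components it
holds, as the definition of compatibility demands.
\<close>

theorem compatible_iff_colored_compat:
  assumes x: "(x, k) \<in> colored_roots \<Phi> a I m" and y: "(y, l) \<in> colored_roots \<Phi> a I m"
  shows "compatible \<Phi> a P N m (x, k) (y, l) \<longleftrightarrow> colored_compat a P N (x, k) (y, l)"
proof -
  have "finite \<Phi>" using roots by (simp add: root_system_def)
  then obtain \<Psi> \<Psi>' where \<Psi>: "\<Psi> \<in> irreducible_components \<Phi>" "x \<in> \<Psi>"
    and \<Psi>': "\<Psi>' \<in> irreducible_components \<Phi>" "y \<in> \<Psi>'"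
    using component_exists colored_root_in[OF x] colored_root_in[OF y] by metis
  have idx_sub: "idx_in X a I \<subseteq> I" for X by (auto simp: idx_in_def)
  have idx_un: "idx_in X a P \<union> idx_in X a N = idx_in X a I" for X by (auto simp: idx_in_def)
  have idx_int: "idx_in X a P = idx_in X a I \<inter> P" "idx_in X a N = idx_in X a I \<inter> N" for X
    by (auto simp: idx_in_def)
  have mem: "z \<in> X" if "(z, n) \<in> colored_roots X a (idx_in X a I) m" "X \<in> irreducible_components \<Phi>" for z n X
    using bipartite_root_system.colored_root_in[OF component_subsystem[OF that(2)]] that(1) idx_un by metis
  have xc: "(x, k) \<in> colored_roots \<Psi> a (idx_in \<Psi> a I) m"
    by (rule colored_roots_subsystem[OF idx_sub \<Psi>(2) component_in_span[OF \<Psi>(1)] x])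
  have yc: "(y, l) \<in> colored_roots \<Psi>' a (idx_in \<Psi>' a I) m"
    by (rule colored_roots_subsystem[OF idx_sub \<Psi>'(2) component_in_span[OF \<Psi>'(1)] y])
  show ?thesis
  proof (cases "\<Psi> = \<Psi>'")
    case False
    then have "compatible \<Phi> a P N m (x, k) (y, l)"
      unfolding compatible_def using xc yc \<Psi>(1) \<Psi>'(1) by blast
    then show ?thesis
      using colored_compat_distinct_components[OF \<Psi>(1) \<Psi>'(1) False \<Psi>(2) \<Psi>'(2)] by blast
  next
    case True
    interpret C: bipartite_root_system \<Psi> a "idx_in \<Psi> a P" "idx_in \<Psi> a N"
      by (rule component_subsystem[OF \<Psi>(1)])
    have first: "\<not> (\<exists>X\<in>irreducible_components \<Phi>. \<exists>Y\<in>irreducible_components \<Phi>. X \<noteq> Y \<and>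
        (x, k) \<in> colored_roots X a (idx_in X a I) m \<and> (y, l) \<in> colored_roots Y a (idx_in Y a I) m)"
      using mem component_unique \<Psi> \<Psi>' True by metis
    have "X = \<Psi>" if "X \<in> irreducible_components \<Phi>"
      "compat_irreducible X a (idx_in X a P) (idx_in X a N) m (x, k) (y, l)" for X
    proof -
      have "(x, k) \<in> colored_roots X a (idx_in X a I) m"
        using that(2) by (simp add: Let_def idx_un)
      then show ?thesis using mem component_unique \<Psi> that(1) by metis
    qed
    then have "compatible \<Phi> a P N m (x, k) (y, l) \<longleftrightarrow>
        compat_irreducible \<Psi> a (idx_in \<Psi> a P) (idx_in \<Psi> a N) m (x, k) (y, l)"
      unfolding compatible_def using first \<Psi>(1) by blast
    also have "\<dots> \<longleftrightarrow> colored_compat a (idx_in \<Psi> a P) (idx_in \<Psi> a N) (x, k) (y, l)"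
      by (rule C.compat_irreducible_iff) (use xc yc True in \<open>simp_all add: idx_un\<close>)
    also have "\<dots> \<longleftrightarrow> colored_compat a P N (x, k) (y, l)"
      unfolding idx_int
      by (rule colored_compat_restrict[OF idx_sub]) (use \<Psi> \<Psi>' True component_in_span[OF \<Psi>(1)] in auto)
    finally show ?thesis .
  qed
qed

end

section \<open>Compatibility in parabolic subsystems\<close>

theorem theorem3p7:
  fixes \<Phi> :: "'v::euclidean_space set"
    and a :: "'i \<Rightarrow> 'v"
    and I Ipos Ineg J :: "'i set"
    and m k l :: nat
    and \<alpha> \<beta> :: 'v
  assumes "root_system \<Phi>"
    and "simple_roots \<Phi> a I"
    and "I = Ipos \<union> Ineg" and "Ipos \<inter> Ineg = {}"
    and "totally_disconnected a Ipos" and "totally_disconnected a Ineg"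
    and "J \<noteq> {}" and "J \<subseteq> I"
    and "(\<alpha>, k) \<in> colored_roots \<Phi> a I m" and "(\<beta>, l) \<in> colored_roots \<Phi> a I m"
    and "\<alpha> \<in> parabolic \<Phi> a J" and "\<beta> \<in> parabolic \<Phi> a J"
  shows "compatible \<Phi> a Ipos Ineg m (\<alpha>, k) (\<beta>, l) \<longleftrightarrow>
         compatible (parabolic \<Phi> a J) a (J \<inter> Ipos) (J \<inter> Ineg) m (\<alpha>, k) (\<beta>, l)"
proof -
  interpret bipartite_root_system \<Phi> a Ipos Ineg
    using assms(1-6) by unfold_locales auto
  have J: "J \<subseteq> Ipos \<union> Ineg" "J \<inter> Ipos \<union> J \<inter> Ineg = J" using assms(3,8) by auto
  interpret J: bipartite_root_system "parabolic \<Phi> a J" a "J \<inter> Ipos" "J \<inter> Ineg"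
    by (rule parabolic_subsystem[OF J(1)])
  have span: "parabolic \<Phi> a J \<subseteq> span (a ` J)" by (auto simp: parabolic_def)
  have colored: "(\<alpha>, k) \<in> colored_roots \<Phi> a (Ipos \<union> Ineg) m" "(\<beta>, l) \<in> colored_roots \<Phi> a (Ipos \<union> Ineg) m"
    using assms(3,9,10) by simp_all
  have "compatible \<Phi> a Ipos Ineg m (\<alpha>, k) (\<beta>, l) \<longleftrightarrow> colored_compat a Ipos Ineg (\<alpha>, k) (\<beta>, l)"
    by (rule compatible_iff_colored_compat[OF colored])
  also have "\<dots> \<longleftrightarrow> colored_compat a (J \<inter> Ipos) (J \<inter> Ineg) (\<alpha>, k) (\<beta>, l)"
    using colored_compat_restrict[OF J(1)] span assms(11,12) by blast
  also have "\<dots> \<longleftrightarrow> compatible (parabolic \<Phi> a J) a (J \<inter> Ipos) (J \<inter> Ineg) m (\<alpha>, k) (\<beta>, l)"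
    using colored_roots_subsystem[OF J(1) assms(11) span colored(1)]
      colored_roots_subsystem[OF J(1) assms(12) span colored(2)]
    by (intro J.compatible_iff_colored_compat[symmetric]) (simp_all add: J(2))
  finally show ?thesis .
qed

end
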